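(* Let $\mathcal P$ be a truncated $d$-polytope and let $K\subset\mathbb R^d$ be any smooth strictly convex body. Then there is a convex polytope in $\mathbb R^d$ combinatorially equivalent to $\mathcal P$ all of whose vertices lie on the boundary of $K$.
   Context: A truncated $d$-polytope is a polytope whose combinatorial type is obtained from a $d$-simplex by repeatedly cutting off (truncating) vertices; equivalently, it is combinatorially dual to a stacked polytope, i.e. one obtained from a simplex by repeatedly gluing a simplex onto a facet. A smooth strictly convex body is a compact convex set with nonempty interior, whose boundary is smooth and contains no line segment. *)

theory Defs
  imports "HOL-Analysis.Analysis"
begin

text \<open>Isomorphism of face lattices; \<^const>\<open>face_of\<close> counts the empty set and the whole
  polytope as faces.\<close>

definition combinatorially_equivalent ::
    "'a::euclidean_space set \<Rightarrow> 'b::euclidean_space set \<Rightarrow> bool" where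
  "combinatorially_equivalent P Q \<longleftrightarrow>
     (\<exists>f. bij_betw f {F. F face_of P} {G. G face_of Q} \<and>
          (\<forall>F F'. F face_of P \<longrightarrow> F' face_of P \<longrightarrow> (f F \<subseteq> f F' \<longleftrightarrow> F \<subseteq> F')))"

text \<open>The cutting hyperplane strictly separates the truncated vertex \<open>v\<close> from all the other
  vertices.\<close>

inductive iterated_vertex_truncation :: "nat \<Rightarrow> 'a::euclidean_space set \<Rightarrow> bool" for d where
  simplex: "int d simplex P \<Longrightarrow> iterated_vertex_truncation d P"
| truncate: "\<lbrakk>iterated_vertex_truncation d P; v extreme_point_of P; a \<bullet> v > b;
     \<And>w. \<lbrakk>w extreme_point_of P; w \<noteq> v\<rbrakk> \<Longrightarrow> a \<bullet> w < b\<rbrakk>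
    \<Longrightarrow> iterated_vertex_truncation d (P \<inter> {x. a \<bullet> x \<le> b})"

text \<open>The ambient dimension \<open>DIM('a)\<close> may exceed \<open>d\<close>.  Only \<open>d \<ge> 1\<close> is meaningful: a
  \<open>0\<close>-simplex has no vertex besides the truncated one, so truncating it yields the empty set.\<close>

definition truncated_polytope :: "nat \<Rightarrow> 'a::euclidean_space set \<Rightarrow> bool" where
  "truncated_polytope d P \<longleftrightarrow>
     polytope P \<and> (\<exists>Q::'a set. iterated_vertex_truncation d Q \<and> combinatorially_equivalent P Q)"

definition convex_body :: "'a::euclidean_space set \<Rightarrow> bool" where
  "convex_body K \<longleftrightarrow> compact K \<and> convex K \<and> interior K \<noteq> {}"

definition supporting_hyperplane_at ::
    "'a::euclidean_space set \<Rightarrow> 'a \<Rightarrow> 'a set \<Rightarrow> bool" where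
  "supporting_hyperplane_at K x H \<longleftrightarrow>
     (\<exists>a b. a \<noteq> 0 \<and> H = {y. a \<bullet> y = b} \<and> x \<in> H \<and> K \<subseteq> {y. a \<bullet> y \<le> b})"

text \<open>Smoothness in the usual sense of convex geometry: every boundary point has a unique
  supporting (tangent) hyperplane.  For convex bodies this amounts to the boundary being a
  hypersurface of class \<open>C\<^sup>1\<close>; in particular every body with a boundary of class
  \<open>C\<^sup>k\<close>, \<open>1 \<le> k \<le> \<infinity>\<close>, is covered.\<close>

definition smooth_boundary :: "'a::euclidean_space set \<Rightarrow> bool" where
  "smooth_boundary K \<longleftrightarrow> (\<forall>x\<in>frontier K. \<exists>!H. supporting_hyperplane_at K x H)"

definition smooth_strictly_convex_body :: "'a::euclidean_space set \<Rightarrow> bool" where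
  "smooth_strictly_convex_body K \<longleftrightarrow>
     convex_body K \<and> smooth_boundary K \<and>
     (\<forall>x y. x \<noteq> y \<longrightarrow> \<not> closed_segment x y \<subseteq> frontier K)"

end

theory Submission
  imports Defs
begin

text \<open>Replay the truncations inside the body, deciding beforehand which vertices survive to the end:
  every realisation has its surviving vertices on the boundary of the body, the vertices still to
  be truncated outside of it, and all its edges pass through the interior.  To truncate a vertex
  outside the body, follow its edges inwards until they enter the body.  Since the vertex is simple,
  the new vertices can be chosen independently on these edges: at the entry point if the vertex is to
  survive, and slightly before it otherwise.  By strict convexity the segments between distinct
  entry points pass through the interior, and this is preserved by small perturbations.  The
  combinatorial type of a truncation depends only on the face lattice and on the truncated vertex.\<close>

section \<open>Isomorphisms of face lattices\<close>

text \<open>Truncating a polytope that is already inscribed cannot work: by strict convexity its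
  open edges lie in the interior of \<open>K\<close>, and a cut places the new vertices on open
  edges. A vertex that will be cut off must therefore wait outside \<open>K\<close>, and what has to
  be realised at one stage is dictated by the later stages. In the induction this plan is a label
  set \<open>S\<close> of faces of the given polytope, kept arbitrary: a truncation at
  \<open>v\<close> is prepared by asking for \<open>S - {{v}}\<close> one stage earlier, and the
  final stage takes all labels. The labels sit on the given polytope because its realisation is only
  being built. The condition on edges drives the step. It makes each edge at a waiting vertex enter
  \<open>K\<close>, and it has to be re-established for the new edges, which are shortened old edges
  or segments between two new vertices. The first kind keeps a point of the interior because the cut
  is made no later than the entry point; the second kind is why the new vertices may leave the entry
  points only by a small amount \<open>t\<close>.\<close>

definition face_iso :: "('a::euclidean_space set \<Rightarrow> 'b::euclidean_space set) \<Rightarrow> 'a set \<Rightarrow> 'b set \<Rightarrow> bool"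
  where "face_iso f P Q \<longleftrightarrow>
     bij_betw f {F. F face_of P} {G. G face_of Q} \<and>
     (\<forall>F F'. F face_of P \<longrightarrow> F' face_of P \<longrightarrow> (f F \<subseteq> f F' \<longleftrightarrow> F \<subseteq> F'))"

lemma combinatorially_equivalent_iff_face_iso:
  "combinatorially_equivalent P Q \<longleftrightarrow> (\<exists>f. face_iso f P Q)"
  by (simp add: combinatorially_equivalent_def face_iso_def)

lemma face_isoI:
  assumes "\<And>F. F face_of P \<Longrightarrow> f F face_of Q"
    and "\<And>F F'. F face_of P \<Longrightarrow> F' face_of P \<Longrightarrow> f F \<subseteq> f F' \<longleftrightarrow> F \<subseteq> F'"
    and "\<And>G. G face_of Q \<Longrightarrow> \<exists>F. F face_of P \<and> f F = G"
  shows "face_iso f P Q"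
proof -
  have "inj_on f {F. F face_of P}"
    by (rule inj_onI) (use assms(2) in \<open>metis mem_Collect_eq subset_antisym order_refl\<close>)
  moreover have "f ` {F. F face_of P} = {G. G face_of Q}"
    using assms(1,3) by fastforce
  ultimately show ?thesis
    unfolding face_iso_def bij_betw_def using assms(2) by blast
qed

lemma
  assumes "face_iso f P Q"
  shows face_iso_face: "F face_of P \<Longrightarrow> f F face_of Q"
    and face_iso_subset: "F face_of P \<Longrightarrow> F' face_of P \<Longrightarrow> f F \<subseteq> f F' \<longleftrightarrow> F \<subseteq> F'"
    and face_iso_surj: "G face_of Q \<Longrightarrow> \<exists>F. F face_of P \<and> f F = G"
proof -
  have im: "f ` {F. F face_of P} = {G. G face_of Q}"
    and sub: "\<forall>F F'. F face_of P \<longrightarrow> F' face_of P \<longrightarrow> (f F \<subseteq> f F' \<longleftrightarrow> F \<subseteq> F')"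
    using assms by (simp_all add: face_iso_def bij_betw_def)
  show "F face_of P \<Longrightarrow> f F face_of Q" using im by blast
  show "F face_of P \<Longrightarrow> F' face_of P \<Longrightarrow> f F \<subseteq> f F' \<longleftrightarrow> F \<subseteq> F'" using sub by blast
  assume "G face_of Q"
  then have "G \<in> f ` {F. F face_of P}" by (simp add: im)
  then show "\<exists>F. F face_of P \<and> f F = G" by blast
qed

lemma face_iso_inverse:
  assumes "face_iso f P Q" shows "\<exists>g. face_iso g Q P"
proof
  let ?g = "inv_into {F. F face_of P} f"
  have fi: "bij_betw f {F. F face_of P} {G. G face_of Q}"
    using assms by (simp add: face_iso_def)
  have g: "?g G face_of P" "f (?g G) = G" if "G face_of Q" for G
    using bij_betw_inv_into[OF fi] bij_betw_inv_into_right[OF fi] that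
    by (auto dest: bij_betwE)
  show "face_iso ?g Q P"
    unfolding face_iso_def
  proof (intro conjI allI impI)
    show "bij_betw ?g {F. F face_of Q} {G. G face_of P}" by (rule bij_betw_inv_into[OF fi])
    fix F F' assume "F face_of Q" "F' face_of Q"
    then show "?g F \<subseteq> ?g F' \<longleftrightarrow> F \<subseteq> F'"
      using face_iso_subset[OF assms, of "?g F" "?g F'"] g by simp
  qed
qed

lemma combinatorially_equivalent_sym:
  "combinatorially_equivalent P Q \<Longrightarrow> combinatorially_equivalent Q P"
  by (auto simp: combinatorially_equivalent_iff_face_iso dest: face_iso_inverse)

lemma combinatorially_equivalent_trans:
  assumes "combinatorially_equivalent P Q" "combinatorially_equivalent Q R"
  shows "combinatorially_equivalent P R"
proof -
  obtain f g where f: "face_iso f P Q" and g: "face_iso g Q R"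
    using assms by (auto simp: combinatorially_equivalent_iff_face_iso)
  have "face_iso (g \<circ> f) P R"
  proof (rule face_isoI)
    fix T assume "T face_of R"
    then show "\<exists>F. F face_of P \<and> (g \<circ> f) F = T"
      using face_iso_surj[OF g] face_iso_surj[OF f] by (metis comp_apply)
  qed (simp_all add: face_iso_face[OF f] face_iso_face[OF g] face_iso_subset[OF f] face_iso_subset[OF g])
  then show ?thesis
    by (auto simp: combinatorially_equivalent_iff_face_iso)
qed

lemma face_iso_empty:
  assumes "face_iso f P Q" shows "f {} = {}"
proof -
  obtain F where F: "F face_of P" "f F = {}"
    using face_iso_surj[OF assms empty_face_of] by blast
  then have "f {} \<subseteq> f F" using face_iso_subset[OF assms empty_face_of] by blast
  then show ?thesis using F by simp
qed

lemma polytope_has_extreme_point: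
  fixes P :: "'a::euclidean_space set"
  assumes "polytope P" "P \<noteq> {}" obtains x where "x extreme_point_of P"
  using extreme_point_exists_convex[OF polytope_imp_compact polytope_imp_convex] assms by blast

text \<open>Vertices are the minimal nonempty faces, a property that an order isomorphism preserves.
  Inside the face sent to \<open>{v}\<close> any extreme point \<open>x\<close> serves:
  \<open>f {x}\<close> is nonempty and contained in \<open>{v}\<close>.\<close>

lemma face_iso_vertex_preimage:
  assumes f: "face_iso f P Q" and P: "polytope P" and v: "v extreme_point_of Q"
  obtains x where "x extreme_point_of P" "f {x} = {v}"
proof -
  obtain F where F: "F face_of P" "f F = {v}"
    using face_iso_surj[OF f] v face_of_singleton by blast
  then have "F \<noteq> {}" using face_iso_empty[OF f] by auto
  then obtain x where x: "x extreme_point_of F"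
    using polytope_has_extreme_point face_of_polytope_polytope[OF P F(1)] by blast
  then have xP: "x extreme_point_of P" "x \<in> F" using extreme_point_of_face[OF F(1)] by auto
  then have "{x} face_of P" using face_of_singleton by blast
  moreover from this have "f {x} \<subseteq> {v}" using face_iso_subset[OF f _ F(1)] F(2) xP(2) by simp
  moreover have "f {x} \<noteq> {}"
    using face_iso_subset[OF f \<open>{x} face_of P\<close> empty_face_of] face_iso_empty[OF f] by auto
  ultimately show thesis using that xP by blast
qed

section \<open>Faces of a polytope cut by a halfspace\<close>

lemma polytope_in_rel_interior_of_face:
  fixes P :: "'a::euclidean_space set"
  assumes P: "polytope P" and p: "p \<in> P"
  obtains F where "F face_of P" "p \<in> rel_interior F"
proof -
  \<comment> \<open>A minimal face through \<open>p\<close> works: its relative boundary is covered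
    by its facets, and a facet containing \<open>p\<close> would be a smaller face through
    \<open>p\<close>.\<close>
  let ?A = "{F. F face_of P \<and> p \<in> F}"
  have "finite ?A" using finite_polytope_faces[OF P] by (rule rev_finite_subset) auto
  moreover have "P \<in> ?A" using P p by (simp add: face_of_refl polytope_imp_convex)
  ultimately have "\<exists>F\<in>?A. \<forall>G\<in>?A. G \<subseteq> F \<longrightarrow> F = G"
    using finite_has_minimal[of ?A] by auto
  then obtain F where F: "F \<in> ?A" "\<And>G. G \<in> ?A \<Longrightarrow> G \<subseteq> F \<Longrightarrow> F = G"
    by blast
  have "polyhedron F"
    using F(1) polytope_imp_polyhedron[OF face_of_polytope_polytope[OF P]] by blast
  have "p \<in> rel_interior F"
  proof (rule ccontr)
    assume "p \<notin> rel_interior F"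
    then have "p \<in> \<Union>{G. G facet_of F}"
      using rel_boundary_of_polyhedron[OF \<open>polyhedron F\<close>] F(1) by blast
    then obtain G where G: "G facet_of F" "p \<in> G" by blast
    have GF: "G face_of F" using G(1) by (rule facet_of_imp_face_of)
    then have "G \<in> ?A" "G \<subseteq> F"
      using F(1) G(2) face_of_trans[OF GF] face_of_imp_subset[OF GF] by auto
    then have "F = G" by (rule F(2))
    then show False using G facet_of_irrefl by blast
  qed
  then show thesis using that F by blast
qed

text \<open>Let \<open>F\<close> be the face of \<open>P\<close> whose relative interior contains a
  relatively interior point \<open>p\<close> of \<open>T\<close>. Then \<open>p\<close> is also
  relatively interior to \<open>F\<close> cut by the hyperplane or the halfspace, depending on
  whether \<open>T\<close> lies in the hyperplane. A face that meets the relative interior of a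
  convex set is the whole set, so \<open>T\<close> is that intersection.\<close>

lemma face_of_Int_halfspace:
  fixes P :: "'a::euclidean_space set"
  assumes P: "polytope P" and T: "T face_of (P \<inter> {x. a \<bullet> x \<le> b})" and "T \<noteq> {}"
  obtains F where "F face_of P" "T = F \<inter> {x. a \<bullet> x \<le> b} \<or> T = F \<inter> {x. a \<bullet> x = b}"
proof -
  let ?L = "{x. a \<bullet> x \<le> b}" and ?H = "{x. a \<bullet> x = b}"
  have cT: "convex T" using T face_of_imp_convex by blast
  have TP: "T \<subseteq> P" "T \<subseteq> ?L" using face_of_imp_subset[OF T] by auto
  obtain p where p: "p \<in> rel_interior T" using cT \<open>T \<noteq> {}\<close> rel_interior_eq_empty by blast
  then have pT: "p \<in> T" using rel_interior_subset by blast
  obtain F where F: "F face_of P" "p \<in> rel_interior F"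
    using polytope_in_rel_interior_of_face[OF P, of p] pT TP by blast
  have TF: "T \<subseteq> F"
    using subset_of_face_of[OF F(1) TP(1)] p F(2) rel_interior_subset by blast
  have cF: "convex F" using F(1) face_of_imp_convex by blast
  have TFL: "T face_of (F \<inter> ?L)"
    by (rule face_of_subset[OF T]) (use TF TP face_of_imp_subset[OF F(1)] in auto)
  show thesis
  proof (cases "T \<subseteq> ?H")
    case True
    have "T face_of (F \<inter> ?H)"
      by (rule face_of_subset[OF TFL]) (use TF True in auto)
    moreover have "p \<in> rel_interior (F \<inter> ?H)"
    proof -
      have "rel_interior ?H = ?H" by (simp add: affine_hyperplane rel_interior_affine)
      moreover have "p \<in> ?H" using pT True by blast
      ultimately show ?thesis
        using convex_rel_interior_inter_two[OF cF convex_hyperplane, of a b] F(2) by auto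
    qed
    ultimately have "T = F \<inter> ?H" using face_of_disjoint_rel_interior pT by blast
    then show ?thesis using that F by blast
  next
    case False
    \<comment> \<open>\<open>T \<inter> ?H\<close> is a proper face of \<open>T\<close> here, so it
      misses the relative interior of \<open>T\<close>.\<close>
    have "p \<notin> ?H"
    proof
      assume "p \<in> ?H"
      have "(T \<inter> ?H) face_of T"
        by (rule face_of_Int_supporting_hyperplane_le[OF cT]) (use TP in auto)
      moreover have "T \<inter> ?H \<noteq> T" using False by auto
      ultimately show False
        using face_of_disjoint_rel_interior p pT \<open>p \<in> ?H\<close> by blast
    qed
    then have "p \<in> {x. a \<bullet> x < b}" using pT TP by auto
    then have "p \<in> interior ?L"
      by (rule interiorI[OF open_halfspace_lt]) auto
    then have "p \<in> rel_interior ?L" using interior_subset_rel_interior by blast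
    then have "p \<in> rel_interior (F \<inter> ?L)"
      using convex_rel_interior_inter_two[OF cF convex_halfspace_le, of a b] F(2) by auto
    then have "T = F \<inter> ?L" using face_of_disjoint_rel_interior[OF TFL] pT by blast
    then show ?thesis using that F by blast
  qed
qed

section \<open>Truncating a vertex\<close>

locale vertex_cut =
  fixes P :: "'a::euclidean_space set" and v a :: 'a and b :: real
  assumes polytope: "polytope P"
    and vertex: "v extreme_point_of P"
    and above: "a \<bullet> v > b"
    and below: "\<And>w. \<lbrakk>w extreme_point_of P; w \<noteq> v\<rbrakk> \<Longrightarrow> a \<bullet> w < b"
begin

definition truncation :: "'a set" where
  "truncation = P \<inter> {x. a \<bullet> x \<le> b}"

text \<open>The faces of the truncation are encoded as pairs: \<^term>\<open>(F, False)\<close> is what remains of the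
  face \<open>F\<close>, and \<^term>\<open>(F, True)\<close> is its trace in the cutting hyperplane.\<close>

definition cut_face :: "'a set \<times> bool \<Rightarrow> 'a set" where
  "cut_face = (\<lambda>(F, c). F \<inter> (if c then {x. a \<bullet> x = b} else {x. a \<bullet> x \<le> b}))"

text \<open>The restrictions make the encoding unique. \<open>{v}\<close> would leave the empty set,
  which \<open>({}, False)\<close> already encodes; a face without \<open>v\<close> stays strictly
  below the hyperplane, so its trace would be empty too.\<close>

definition cut_index :: "('a set \<times> bool) set" where
  "cut_index = {(F, c). F face_of P \<and> F \<noteq> {v} \<and> (c \<longrightarrow> v \<in> F)}"

lemma polytope_truncation: "polytope truncation"
  unfolding truncation_def
  by (rule polytope_Int_polyhedron[OF polytope polyhedron_halfspace_le])

lemma convex_truncation: "convex truncation"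
  by (rule polytope_imp_convex[OF polytope_truncation])

lemma face_eq_hull:
  assumes "F face_of P" shows "F = convex hull {x. x extreme_point_of P \<and> x \<in> F}"
proof -
  have "polytope F" by (rule face_of_polytope_polytope[OF polytope assms])
  then have "F = convex hull {x. x extreme_point_of F}"
    by (intro Krein_Milman_Minkowski polytope_imp_compact polytope_imp_convex)
  then show ?thesis by (simp add: extreme_point_of_face[OF assms])
qed

lemma face_below:
  assumes "F face_of P" "v \<notin> F" "x \<in> F" shows "a \<bullet> x < b"
proof -
  have "convex hull {x. x extreme_point_of P \<and> x \<in> F} \<subseteq> {x. a \<bullet> x < b}"
    by (rule hull_minimal) (use below assms(2) in \<open>auto simp: convex_halfspace_lt\<close>)
  then show ?thesis using assms(3) face_eq_hull[OF assms(1)] by auto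
qed

lemma face_other_vertex:
  assumes "F face_of P" "v \<in> F" "F \<noteq> {v}"
  obtains w where "w extreme_point_of P" "w \<in> F" "w \<noteq> v"
proof -
  have "\<not> {x. x extreme_point_of P \<and> x \<in> F} \<subseteq> {v}"
  proof
    assume "{x. x extreme_point_of P \<and> x \<in> F} \<subseteq> {v}"
    then have "convex hull {x. x extreme_point_of P \<and> x \<in> F} \<subseteq> {v}"
      by (rule hull_minimal) simp
    then have "F \<subseteq> {v}" using face_eq_hull[OF assms(1)] by simp
    then show False using assms by auto
  qed
  then show thesis using that by auto
qed

text \<open>\<open>F\<close> has vertices strictly on both sides of the hyperplane. Its relative
  interior is dense in \<open>F\<close>, hence also has points on both sides, and it is
  connected.\<close>

lemma face_meets_hyperplane:
  assumes "F face_of P" "v \<in> F" "F \<noteq> {v}"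
  obtains p where "p \<in> rel_interior F" "a \<bullet> p = b"
proof -
  obtain w where w: "w \<in> F" "a \<bullet> w < b" using face_other_vertex[OF assms] below by metis
  have cF: "convex F" using assms(1) face_of_imp_convex by blast
  have Fcl: "F \<subseteq> closure (rel_interior F)"
    using convex_closure_rel_interior[OF cF] closure_subset by simp
  have "\<exists>x\<in>rel_interior F. a \<bullet> x < b"
  proof (rule ccontr)
    assume "\<not> ?thesis"
    then have "closure (rel_interior F) \<subseteq> {x. a \<bullet> x \<ge> b}"
      by (intro closure_minimal) (auto simp: closed_halfspace_ge not_less)
    then have "w \<in> {x. a \<bullet> x \<ge> b}" using w Fcl by blast
    then show False using w by simp
  qed
  moreover have "\<exists>x\<in>rel_interior F. a \<bullet> x > b"
  proof (rule ccontr)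
    assume "\<not> ?thesis"
    then have "closure (rel_interior F) \<subseteq> {x. a \<bullet> x \<le> b}"
      by (intro closure_minimal) (auto simp: closed_halfspace_le not_less)
    then have "v \<in> {x. a \<bullet> x \<le> b}" using assms(2) Fcl by blast
    then show False using above by simp
  qed
  moreover have "connected (rel_interior F)"
    using cF convex_rel_interior convex_connected by blast
  ultimately have "\<exists>z\<in>rel_interior F. a \<bullet> z = b"
    using connected_ivt_hyperplane[of "rel_interior F" _ _ a b] by (meson less_imp_le)
  then show thesis using that by blast
qed

text \<open>The right-hand side mentions neither \<open>a\<close> nor \<open>b\<close>: this is why
  the face lattice of the truncation depends only on the face lattice of \<open>P\<close> and on
  \<open>v\<close>. The empty face needs its own disjunct, being the only face without
  \<open>v\<close> that fits into a trace.\<close>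

lemma cut_face_subset_iff:
  assumes "(F, c) \<in> cut_index" "(G, c') \<in> cut_index"
  shows "cut_face (F, c) \<subseteq> cut_face (G, c') \<longleftrightarrow> F \<subseteq> G \<and> (c' \<longrightarrow> c \<or> F = {})"
proof
  have F: "F face_of P" "F \<noteq> {v}" "c \<Longrightarrow> v \<in> F" and G: "G face_of P" "G \<noteq> {v}" "c' \<Longrightarrow> v \<in> G"
    using assms by (auto simp: cut_index_def)
  assume sub: "cut_face (F, c) \<subseteq> cut_face (G, c')"
  show "F \<subseteq> G \<and> (c' \<longrightarrow> c \<or> F = {})"
  proof (cases "v \<in> F")
    case True
    \<comment> \<open>\<open>p\<close> belongs to the cut face for either value of \<open>c\<close>,
      and a face \<open>G\<close> containing a relatively interior point of \<open>F\<close>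
      contains \<open>F\<close>.\<close>
    obtain p where p: "p \<in> rel_interior F" "a \<bullet> p = b"
      using face_meets_hyperplane F True by blast
    then have "p \<in> cut_face (F, c)" using rel_interior_subset by (auto simp: cut_face_def)
    then have "p \<in> G" using sub by (auto simp: cut_face_def split: if_splits)
    then have "F \<subseteq> G"
      using subset_of_face_of[OF G(1) face_of_imp_subset[OF F(1)]] p by blast
    \<comment> \<open>A vertex strictly below the hyperplane separates what remains of
      \<open>F\<close> from every trace.\<close>
    moreover obtain w where "w \<in> F" "a \<bullet> w < b"
      using face_other_vertex[OF F(1) True F(2)] below by metis
    then have "c' \<longrightarrow> c" using sub by (auto simp: cut_face_def split: if_splits)
    ultimately show ?thesis by blast
  next
    case False
    then have "\<not> c" using F by auto
    moreover have "a \<bullet> x < b" if "x \<in> F" for x using face_below[OF F(1) False that] .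
    ultimately show ?thesis using sub by (force simp: cut_face_def split: if_splits)
  qed
next
  assume "F \<subseteq> G \<and> (c' \<longrightarrow> c \<or> F = {})"
  then show "cut_face (F, c) \<subseteq> cut_face (G, c')"
    by (auto simp: cut_face_def)
qed

lemma cut_face_face:
  assumes "k \<in> cut_index" shows "cut_face k face_of truncation"
proof -
  obtain F c where k: "k = (F, c)" by fastforce
  then have "F face_of P" using assms by (auto simp: cut_index_def)
  then have 1: "F \<inter> {x. a \<bullet> x \<le> b} face_of truncation"
    unfolding truncation_def by (simp add: convex_halfspace_le face_of_slice)
  moreover have "F \<inter> {x. a \<bullet> x \<le> b} \<inter> {x. a \<bullet> x = b} face_of F \<inter> {x. a \<bullet> x \<le> b}"
    by (rule face_of_Int_supporting_hyperplane_le) (use face_of_imp_convex[OF 1] in auto)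
  moreover have "F \<inter> {x. a \<bullet> x \<le> b} \<inter> {x. a \<bullet> x = b} = F \<inter> {x. a \<bullet> x = b}" by auto
  ultimately show ?thesis using face_of_trans[OF _ 1] by (cases c) (simp_all add: k cut_face_def)
qed

lemma cut_face_surj:
  assumes "T face_of truncation" shows "\<exists>k\<in>cut_index. T = cut_face k"
proof (cases "T = {}")
  case True
  then show ?thesis by (intro bexI[of _ "({}, False)"]) (auto simp: cut_index_def cut_face_def)
next
  case False
  then obtain F where F: "F face_of P"
    and T: "T = F \<inter> {x. a \<bullet> x \<le> b} \<or> T = F \<inter> {x. a \<bullet> x = b}"
    using face_of_Int_halfspace[OF polytope assms[unfolded truncation_def]] by metis
  have "F \<noteq> {v}" using T False above by auto
  show ?thesis
  proof (cases "T = F \<inter> {x. a \<bullet> x \<le> b}")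
    case True
    then show ?thesis using F \<open>F \<noteq> {v}\<close>
      by (intro bexI[of _ "(F, False)"]) (auto simp: cut_index_def cut_face_def)
  next
    case 2: False
    then have "T = F \<inter> {x. a \<bullet> x = b}" using T by blast
    moreover from this have "v \<in> F" using face_below[OF F] False by fastforce
    ultimately show ?thesis using F \<open>F \<noteq> {v}\<close>
      by (intro bexI[of _ "(F, True)"]) (auto simp: cut_index_def cut_face_def)
  qed
qed

lemma cut_face_cases:
  assumes "T face_of truncation"
  obtains F c where "(F, c) \<in> cut_index" "T = cut_face (F, c)"
  using cut_face_surj[OF assms] by (metis surj_pair)

end

text \<open>The isomorphism acts on indices by mapping \<open>(F, c)\<close> to
  \<open>(f F, c)\<close>, and inclusion is decided by the same formula on both sides. The explicit
  values of \<open>g\<close> are exported since they tell which vertex of the second truncation a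
  new vertex corresponds to.\<close>

lemma face_iso_truncation:
  assumes P: "vertex_cut P v a b" and Q: "vertex_cut Q w a' b'"
    and f: "face_iso f P Q" and fv: "f {v} = {w}"
  obtains g where "face_iso g (vertex_cut.truncation P a b) (vertex_cut.truncation Q a' b')"
    "\<And>F c. (F, c) \<in> vertex_cut.cut_index P v \<Longrightarrow>
       g (vertex_cut.cut_face a b (F, c)) = vertex_cut.cut_face a' b' (f F, c)"
proof -
  interpret P: vertex_cut P v a b by fact
  interpret Q: vertex_cut Q w a' b' by fact
  have fv_sub: "{w} \<subseteq> f F \<longleftrightarrow> v \<in> F" if "F face_of P" for F
    using face_iso_subset[OF f _ that, of "{v}"] P.vertex by (simp add: fv face_of_singleton)
  have f_eq: "f F = f F' \<longleftrightarrow> F = F'" if "F face_of P" "F' face_of P" for F F'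
    using face_iso_subset[OF f] that by (metis subset_antisym order_refl)
  have vP: "{v} face_of P" using P.vertex face_of_singleton by blast
  have index: "(f F, c) \<in> Q.cut_index \<longleftrightarrow> (F, c) \<in> P.cut_index" if "F face_of P" for F c
    using fv_sub[OF that] f_eq[OF that vP] fv face_iso_face[OF f that] that
    by (auto simp: P.cut_index_def Q.cut_index_def)
  \<comment> \<open>The value is chosen through some pair representing \<open>T\<close>;
    \<open>sub\<close>, used in both directions, shows that it does not depend on the pair.\<close>
  define g where "g T = (SOME U. \<exists>F c. (F, c) \<in> P.cut_index \<and> T = P.cut_face (F, c) \<and>
    U = Q.cut_face (f F, c))" for T
  have sub: "Q.cut_face (f F, c) \<subseteq> Q.cut_face (f G, c') \<longleftrightarrow> P.cut_face (F, c) \<subseteq> P.cut_face (G, c')"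
    if "(F, c) \<in> P.cut_index" "(G, c') \<in> P.cut_index" for F c G c'
  proof -
    have "F face_of P" "G face_of P" using that by (auto simp: P.cut_index_def)
    moreover from this have "f F = {} \<longleftrightarrow> F = {}"
      using f_eq[OF _ empty_face_of] face_iso_empty[OF f] by simp
    ultimately show ?thesis
      using that index by (simp add: P.cut_face_subset_iff Q.cut_face_subset_iff face_iso_subset[OF f])
  qed
  have g: "g (P.cut_face (F, c)) = Q.cut_face (f F, c)" if "(F, c) \<in> P.cut_index" for F c
  proof -
    have "\<exists>F' c'. (F', c') \<in> P.cut_index \<and> P.cut_face (F, c) = P.cut_face (F', c') \<and>
        g (P.cut_face (F, c)) = Q.cut_face (f F', c')"
      unfolding g_def by (rule someI_ex) (use that in blast)
    then obtain F' c' where k: "(F', c') \<in> P.cut_index" "P.cut_face (F, c) = P.cut_face (F', c')"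
      "g (P.cut_face (F, c)) = Q.cut_face (f F', c')" by blast
    then show ?thesis using sub[OF that k(1)] sub[OF k(1) that] by blast
  qed
  have "face_iso g P.truncation Q.truncation"
  proof (rule face_isoI)
    fix T assume "T face_of P.truncation"
    then obtain F c where k: "(F, c) \<in> P.cut_index" "T = P.cut_face (F, c)"
      by (elim P.cut_face_cases)
    then have "F face_of P" by (auto simp: P.cut_index_def)
    then show "g T face_of Q.truncation" using k by (simp add: index g Q.cut_face_face)
  next
    fix T U assume "T face_of P.truncation" "U face_of P.truncation"
    then obtain F c G c' where "(F, c) \<in> P.cut_index" "T = P.cut_face (F, c)"
      "(G, c') \<in> P.cut_index" "U = P.cut_face (G, c')"
      by (elim P.cut_face_cases)
    then show "g T \<subseteq> g U \<longleftrightarrow> T \<subseteq> U" by (simp add: sub g)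
  next
    fix U assume "U face_of Q.truncation"
    then obtain G c where G: "(G, c) \<in> Q.cut_index" "U = Q.cut_face (G, c)"
      by (elim Q.cut_face_cases)
    then have "G face_of Q" by (auto simp: Q.cut_index_def)
    then obtain F where F: "F face_of P" "f F = G" using face_iso_surj[OF f] by blast
    then have "(F, c) \<in> P.cut_index" using index G by blast
    then show "\<exists>T. T face_of P.truncation \<and> g T = U"
      using P.cut_face_face g F G by (intro exI[of _ "P.cut_face (F, c)"]) simp
  qed
  then show thesis by (rule that) (rule g)
qed

section \<open>Simple vertices\<close>

lemma extreme_point_of_segment_face:
  fixes x y :: "'a::euclidean_space"
  assumes "closed_segment x y face_of P"
  shows "x extreme_point_of P" "y extreme_point_of P"
  using extreme_point_of_face[OF assms] extreme_point_of_segment by blast+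

lemma extreme_point_of_subset:
  assumes "x extreme_point_of P" "S \<subseteq> P" "x \<in> S"
  shows "x extreme_point_of S"
  using assms unfolding extreme_point_of_def by blast

lemma closed_segment_ray:
  fixes v n :: "'a::real_vector"
  assumes "s \<le> t"
  shows "closed_segment (v + s *\<^sub>R n) (v + t *\<^sub>R n) = (\<lambda>r. v + r *\<^sub>R n) ` {s..t}"
proof -
  have "linear (\<lambda>r::real. r *\<^sub>R n)" by (simp add: linear_scale_left)
  then have "closed_segment (s *\<^sub>R n) (t *\<^sub>R n) = (\<lambda>r. r *\<^sub>R n) ` {s..t}"
    using closed_segment_linear_image[of "\<lambda>r. r *\<^sub>R n" s t] closed_segment_eq_real_ivl1[OF assms] by simp
  then show ?thesis by (simp add: closed_segment_translation image_image)
qed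

text \<open>As many independent vectors as the dimension form a basis, so a functional may be
  prescribed on them. It is obtained by applying the adjoint of a left inverse of the base change
  \<open>T\<close> to the vector with coordinates \<open>\<beta>\<close>.\<close>

lemma exists_functional_on_frame:
  fixes n :: "'a::euclidean_space \<Rightarrow> 'a"
  assumes ind: "\<And>z. (\<Sum>i\<in>Basis. z i *\<^sub>R n i) = 0 \<Longrightarrow> \<forall>i\<in>Basis. z i = 0"
  obtains h where "\<And>i. i \<in> Basis \<Longrightarrow> h \<bullet> n i = \<beta> i"
proof -
  define T where "T x = (\<Sum>i\<in>Basis. (x \<bullet> i) *\<^sub>R n i)" for x
  have lin: "linear T"
    by (rule linearI) (simp_all add: T_def inner_left_distrib scaleR_add_left sum.distrib scaleR_sum_right)
  have "inj T"
  proof (subst linear_injective_0[OF lin], intro allI impI)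
    fix x assume "T x = 0"
    then have "\<forall>i\<in>Basis. x \<bullet> i = 0" unfolding T_def by (rule ind)
    then show "x = 0" by (simp add: euclidean_all_zero_iff)
  qed
  then obtain g where g: "linear g" "g \<circ> T = id" using linear_injective_left_inverse[OF lin] by blast
  have Tn: "T i = n i" if "i \<in> Basis" for i
  proof -
    have "T i = (\<Sum>j\<in>Basis. if j = i then n i else 0)"
      unfolding T_def by (rule sum.cong) (use that in \<open>auto simp: inner_Basis\<close>)
    then show ?thesis using that by simp
  qed
  show thesis
  proof (rule that)
    fix i :: 'a assume i: "i \<in> Basis"
    have "adjoint g (\<Sum>j\<in>Basis. \<beta> j *\<^sub>R j) \<bullet> n i = (\<Sum>j\<in>Basis. \<beta> j *\<^sub>R j) \<bullet> g (n i)"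
      by (simp add: adjoint_clauses(2)[OF g(1)])
    also have "g (n i) = i" using g(2) Tn[OF i] by (metis comp_apply id_apply)
    finally show "adjoint g (\<Sum>j\<in>Basis. \<beta> j *\<^sub>R j) \<bullet> n i = \<beta> i"
      using i by simp
  qed
qed

text \<open>A simple vertex of a full-dimensional polytope: \<^term>\<open>n i\<close> are the directions of its
  edges, indexed for convenience by the standard basis.\<close>

definition vertex_frame :: "'a::euclidean_space set \<Rightarrow> 'a \<Rightarrow> ('a \<Rightarrow> 'a) \<Rightarrow> bool" where
  "vertex_frame P v n \<longleftrightarrow>
     (\<forall>i\<in>Basis. closed_segment v (v + n i) face_of P) \<and>
     (\<forall>z. (\<Sum>i\<in>Basis. z i *\<^sub>R n i) = 0 \<longrightarrow> (\<forall>i\<in>Basis. z i = 0)) \<and>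
     (\<forall>x\<in>P. \<exists>z. (\<forall>i\<in>Basis. 0 \<le> z i) \<and> x = v + (\<Sum>i\<in>Basis. z i *\<^sub>R n i))"

definition simple_polytope :: "'a::euclidean_space set \<Rightarrow> bool" where
  "simple_polytope P \<longleftrightarrow>
     polytope P \<and> (\<forall>v. v extreme_point_of P \<longrightarrow> (\<exists>n. vertex_frame P v n))"

lemma vertex_frame_independent:
  assumes "vertex_frame P v n" "(\<Sum>i\<in>Basis. z i *\<^sub>R n i) = 0"
  shows "\<forall>i\<in>Basis. z i = 0"
  using assms unfolding vertex_frame_def by blast

lemma vertex_frame_nonzero:
  assumes n: "vertex_frame P v n" and i: "i \<in> Basis" shows "n i \<noteq> 0"
proof
  assume "n i = 0"
  then have "(\<Sum>j\<in>Basis. (if j = i then 1 else 0) *\<^sub>R n j) = 0"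
    by (intro sum.neutral) auto
  from vertex_frame_independent[OF n this] show False using i by auto
qed

text \<open>Rescaling edge directions by positive factors keeps both the cone they span and their
  independence. It serves vertices whose edges are merely shortened by a cut.\<close>

lemma vertex_frame_scale:
  assumes n: "vertex_frame P v n"
    and q: "\<And>i. i \<in> Basis \<Longrightarrow> 0 < q i"
    and edge: "\<And>i. i \<in> Basis \<Longrightarrow> closed_segment v (v + q i *\<^sub>R n i) face_of Q"
    and "Q \<subseteq> P"
  shows "vertex_frame Q v (\<lambda>i. q i *\<^sub>R n i)"
  unfolding vertex_frame_def
proof (intro conjI ballI allI impI)
  fix i :: 'a assume "i \<in> Basis"
  then show "closed_segment v (v + q i *\<^sub>R n i) face_of Q" by (rule edge)
next
  fix z and i :: 'a assume 0: "(\<Sum>i\<in>Basis. z i *\<^sub>R q i *\<^sub>R n i) = 0" and i: "i \<in> Basis"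
  have "(\<Sum>i\<in>Basis. (z i * q i) *\<^sub>R n i) = 0" using 0 by simp
  then have "\<forall>i\<in>Basis. z i * q i = 0" by (rule vertex_frame_independent[OF n])
  then show "z i = 0" using q[OF i] i by auto
next
  fix x assume "x \<in> Q"
  then obtain z where z: "\<forall>i\<in>Basis. 0 \<le> z i" "x = v + (\<Sum>i\<in>Basis. z i *\<^sub>R n i)"
    using n subsetD[OF \<open>Q \<subseteq> P\<close>] unfolding vertex_frame_def by blast
  have "(\<Sum>i\<in>Basis. (z i / q i) *\<^sub>R q i *\<^sub>R n i) = (\<Sum>i\<in>Basis. z i *\<^sub>R n i)"
  proof (rule sum.cong[OF refl])
    fix i :: 'a assume "i \<in> Basis"
    then show "(z i / q i) *\<^sub>R q i *\<^sub>R n i = z i *\<^sub>R n i" using q[of i] by simp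
  qed
  then show "\<exists>z. (\<forall>i\<in>Basis. 0 \<le> z i) \<and> x = v + (\<Sum>i\<in>Basis. z i *\<^sub>R q i *\<^sub>R n i)"
    using z q by (intro exI[of _ "\<lambda>i. z i / q i"]) (auto simp: less_imp_le)
qed

section \<open>Cutting off a simple vertex, in coordinates\<close>

locale framed_cut = vertex_cut +
  fixes n :: "'a \<Rightarrow> 'a"
  assumes frame: "vertex_frame P v n"
begin

text \<open>The parameter at which the ray \<open>v + r *\<^sub>R n i\<close> crosses the cutting
  hyperplane; \<open>y i\<close> is the crossing point.\<close>

definition s :: "'a \<Rightarrow> real" where "s i = (a \<bullet> v - b) / - (a \<bullet> n i)"

definition y :: "'a \<Rightarrow> 'a" where "y i = v + s i *\<^sub>R n i"

lemma edge: "i \<in> Basis \<Longrightarrow> closed_segment v (v + n i) face_of P"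
  using frame by (simp add: vertex_frame_def)

lemma n_nonzero: "i \<in> Basis \<Longrightarrow> n i \<noteq> 0"
  by (rule vertex_frame_nonzero[OF frame])

lemma n_below: assumes "i \<in> Basis" shows "a \<bullet> (v + n i) < b"
  using below[OF extreme_point_of_segment_face(2)[OF edge[OF assms]]] n_nonzero[OF assms] by simp

lemma s: assumes "i \<in> Basis" shows "0 < s i" "s i < 1" "s i * (a \<bullet> n i) = - (a \<bullet> v - b)"
  using n_below[OF assms] above by (auto simp: s_def inner_add_right field_simps)

lemma y_on: "i \<in> Basis \<Longrightarrow> a \<bullet> y i = b"
  using s(3) by (simp add: y_def inner_add_right)

text \<open>All \<open>y i\<close> lie on the cutting hyperplane. In coordinates \<open>c\<close>
  along \<open>y i - v\<close> it thus has the equation that the coordinates sum to 1, and the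
  remaining halfspace is where they sum to at least 1.\<close>

lemma inner_coords:
  "a \<bullet> (v + (\<Sum>i\<in>Basis. c i *\<^sub>R (y i - v))) = a \<bullet> v - (a \<bullet> v - b) * (\<Sum>i\<in>Basis. c i)"
proof -
  have "(\<Sum>i\<in>Basis. c i * (a \<bullet> (y i - v))) = (\<Sum>i\<in>Basis. - (a \<bullet> v - b) * c i)"
    by (rule sum.cong) (auto simp: inner_diff_right y_on algebra_simps)
  also have "\<dots> = - (a \<bullet> v - b) * (\<Sum>i\<in>Basis. c i)" by (rule sum_distrib_left[symmetric])
  finally have "a \<bullet> (\<Sum>i\<in>Basis. c i *\<^sub>R (y i - v)) = - (a \<bullet> v - b) * (\<Sum>i\<in>Basis. c i)"
    by (simp only: inner_sum_right inner_scaleR_right)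
  then show ?thesis by (simp only: inner_add_right)
qed

lemma coords:
  assumes "x \<in> P"
  obtains c where "\<forall>i\<in>Basis. 0 \<le> c i" "x = v + (\<Sum>i\<in>Basis. c i *\<^sub>R (y i - v))"
proof -
  obtain z where z: "\<forall>i\<in>Basis. 0 \<le> z i" "x = v + (\<Sum>i\<in>Basis. z i *\<^sub>R n i)"
    using frame assms by (auto simp: vertex_frame_def)
  have "(\<Sum>i\<in>Basis. (z i / s i) *\<^sub>R (y i - v)) = (\<Sum>i\<in>Basis. z i *\<^sub>R n i)"
  proof (rule sum.cong[OF refl])
    fix i :: 'a assume "i \<in> Basis"
    then show "(z i / s i) *\<^sub>R (y i - v) = z i *\<^sub>R n i"
      using s(1)[of i] by (simp add: y_def)
  qed
  then show thesis
    using z s(1) by (intro that[of "\<lambda>i. z i / s i"]) (auto simp: less_imp_le)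
qed

lemma truncation_coords:
  assumes "x \<in> truncation"
  obtains c where "\<forall>i\<in>Basis. 0 \<le> c i" "x = v + (\<Sum>i\<in>Basis. c i *\<^sub>R (y i - v))"
    "(\<Sum>i\<in>Basis. c i) \<ge> 1"
proof -
  obtain c where c: "\<forall>i\<in>Basis. 0 \<le> c i" "x = v + (\<Sum>i\<in>Basis. c i *\<^sub>R (y i - v))"
    using coords assms unfolding truncation_def by blast
  have "(a \<bullet> v - b) * (\<Sum>i\<in>Basis. c i) \<ge> (a \<bullet> v - b) * 1"
    using assms c(2) inner_coords[of c] by (simp add: truncation_def)
  then have "(\<Sum>i\<in>Basis. c i) \<ge> 1" using above mult_le_cancel_left_pos[of "a \<bullet> v - b"] by simp
  then show thesis using that c by blast
qed

lemma cut_edge: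
  assumes i: "i \<in> Basis"
  shows "(closed_segment v (v + n i), c) \<in> cut_index"
    and "cut_face (closed_segment v (v + n i), True) = {y i}"
    and "cut_face (closed_segment v (v + n i), False) = closed_segment (y i) (v + n i)"
proof -
  have "v + n i \<in> closed_segment v (v + n i)" by simp
  then have "closed_segment v (v + n i) \<noteq> {v}" using n_nonzero[OF i] by force
  then show "(closed_segment v (v + n i), c) \<in> cut_index"
    using edge[OF i] by (simp add: cut_index_def)
  have seg: "closed_segment v (v + n i) = (\<lambda>r. v + r *\<^sub>R n i) ` {0..1}"
    using closed_segment_ray[of 0 1 v "n i"] by simp
  have neg: "a \<bullet> n i < 0" using n_below[OF i] above by (simp add: inner_add_right)
  \<comment> \<open>Along the edge, \<open>a\<close> is affine with negative slope and takes the
    value \<open>b\<close> at \<open>s i\<close>.\<close>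
  have eq: "a \<bullet> (v + r *\<^sub>R n i) - b = (r - s i) * (a \<bullet> n i)" for r
    using s(3)[OF i] by (simp add: inner_add_right algebra_simps)
  have iff: "a \<bullet> (v + r *\<^sub>R n i) = b \<longleftrightarrow> r = s i" "a \<bullet> (v + r *\<^sub>R n i) \<le> b \<longleftrightarrow> s i \<le> r" for r
  proof -
    show "a \<bullet> (v + r *\<^sub>R n i) = b \<longleftrightarrow> r = s i" using eq[of r] neg by auto
    have "a \<bullet> (v + r *\<^sub>R n i) \<le> b \<longleftrightarrow> (r - s i) * (a \<bullet> n i) \<le> 0" using eq[of r] by linarith
    also have "\<dots> \<longleftrightarrow> s i \<le> r" using neg by (auto simp: mult_le_0_iff)
    finally show "a \<bullet> (v + r *\<^sub>R n i) \<le> b \<longleftrightarrow> s i \<le> r" .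
  qed
  show "cut_face (closed_segment v (v + n i), True) = {y i}"
  proof -
    have "v + s i *\<^sub>R n i \<in> closed_segment v (v + n i)" unfolding seg
      by (rule imageI) (use s(1,2)[OF i] in simp)
    moreover have "x = v + s i *\<^sub>R n i" if x: "x \<in> closed_segment v (v + n i)" "a \<bullet> x = b" for x
    proof -
      obtain r where "x = v + r *\<^sub>R n i" using x(1) unfolding seg by blast
      then show ?thesis using iff(1) x(2) by metis
    qed
    moreover have "a \<bullet> (v + s i *\<^sub>R n i) = b" using y_on[OF i] unfolding y_def .
    ultimately have "closed_segment v (v + n i) \<inter> {x. a \<bullet> x = b} = {v + s i *\<^sub>R n i}" by blast
    then show ?thesis by (simp only: cut_face_def y_def prod.case if_True)
  qed
  have "closed_segment (y i) (v + n i) = (\<lambda>r. v + r *\<^sub>R n i) ` {s i..1}"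
    using closed_segment_ray[of "s i" 1 v "n i"] s(2)[OF i] by (simp add: y_def)
  then show "cut_face (closed_segment v (v + n i), False) = closed_segment (y i) (v + n i)"
  proof -
    have "(\<lambda>r. v + r *\<^sub>R n i) ` {0..1} \<inter> {x. a \<bullet> x \<le> b} =
        (\<lambda>r. v + r *\<^sub>R n i) ` {r \<in> {0..1}. a \<bullet> (v + r *\<^sub>R n i) \<le> b}" by blast
    also have "{r \<in> {0..1}. a \<bullet> (v + r *\<^sub>R n i) \<le> b} = {s i..1}"
      unfolding iff(2) using s(1)[OF i] by auto
    finally show ?thesis
      using \<open>closed_segment (y i) (v + n i) = _\<close> by (simp add: cut_face_def seg)
  qed
qed

lemma y_in: "i \<in> Basis \<Longrightarrow> y i \<in> truncation"
  using face_of_imp_subset[OF cut_face_face[OF cut_edge(1), of i True]] by (simp add: cut_edge(2))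

text \<open>If the face \<open>F\<close> behind \<open>{x}\<close> avoids \<open>v\<close>, the cut
  leaves it alone and \<open>x\<close> is an old vertex. Otherwise \<open>F\<close> meets the
  hyperplane, necessarily in \<open>x\<close>; there the coordinates sum to 1, so \<open>x\<close>
  is a convex combination of the \<open>y i\<close> and, being extreme, equals one of them.\<close>

lemma extreme_point_of_truncation_cases:
  assumes x: "x extreme_point_of truncation"
  obtains "x extreme_point_of P" "x \<noteq> v" "a \<bullet> x < b" | i where "i \<in> Basis" "x = y i"
proof -
  have "{x} face_of truncation" using x face_of_singleton by blast
  then obtain F c where F: "(F, c) \<in> cut_index" "{x} = cut_face (F, c)" by (rule cut_face_cases)
  then have FP: "F face_of P" "F \<noteq> {v}" by (auto simp: cut_index_def)
  show thesis
  proof (cases "v \<in> F")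
    case False
    then have "\<not> c" using F by (auto simp: cut_index_def)
    have "F \<subseteq> {x. a \<bullet> x \<le> b}" using face_below[OF FP(1) False] by (auto intro: less_imp_le)
    then have "F = {x}" using F \<open>\<not> c\<close> by (auto simp: cut_face_def)
    then have "x extreme_point_of P" "x \<noteq> v" using FP face_of_singleton by auto
    then show thesis using below that(1) by blast
  next
    case True
    then obtain p where "p \<in> rel_interior F" "a \<bullet> p = b" using face_meets_hyperplane FP by blast
    then have "p \<in> cut_face (F, c)" using rel_interior_subset by (auto simp: cut_face_def)
    then have "p = x" using F(2) by blast
    then have ax: "a \<bullet> x = b" using \<open>a \<bullet> p = b\<close> by simp
    have xt: "x \<in> truncation" using x by (simp add: extreme_point_of_def)
    then obtain c where c: "\<forall>i\<in>Basis. 0 \<le> c i" "x = v + (\<Sum>i\<in>Basis. c i *\<^sub>R (y i - v))"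
      using coords unfolding truncation_def by blast
    have "a \<bullet> x = a \<bullet> v - (a \<bullet> v - b) * (\<Sum>i\<in>Basis. c i)"
      unfolding c(2) by (rule inner_coords)
    then have "(a \<bullet> v - b) * (\<Sum>i\<in>Basis. c i) = (a \<bullet> v - b) * 1"
      unfolding ax by (simp only: mult_1_right)
    then have "(\<Sum>i\<in>Basis. c i) = 1" unfolding mult_cancel_left using above by simp
    moreover from this have "x = (\<Sum>i\<in>Basis. c i *\<^sub>R y i)"
      using c(2) by (simp add: scaleR_diff_right sum_subtractf flip: scaleR_sum_left)
    moreover from \<open>(\<Sum>i\<in>Basis. c i) = 1\<close> have "(\<Sum>i\<in>Basis. c i *\<^sub>R y i) \<in> convex hull (y ` Basis)"
      by (intro convex_sum) (use c(1) in \<open>auto intro: hull_inc\<close>)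
    ultimately have "x \<in> convex hull (y ` Basis)" by simp
    moreover have "convex hull (y ` Basis) \<subseteq> truncation"
      using y_in convex_truncation by (intro hull_minimal) auto
    ultimately have "x extreme_point_of convex hull (y ` Basis)"
      using extreme_point_of_subset x by blast
    then show thesis using extreme_point_of_convex_hull that(2) by blast
  qed
qed

lemma y_independent:
  assumes "(\<Sum>i\<in>Basis. z i *\<^sub>R (y i - v)) = 0" shows "\<forall>i\<in>Basis. z i = 0"
proof -
  have "(\<Sum>i\<in>Basis. (z i * s i) *\<^sub>R n i) = 0" using assms by (simp add: y_def)
  then have "\<forall>i\<in>Basis. z i * s i = 0" by (rule vertex_frame_independent[OF frame])
  then show ?thesis using s(1) by (metis less_irrefl mult_eq_0_iff)
qed

text \<open>The new facet is a simplex spanned by the points \<open>y i\<close>, so any two of them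
  are joined by an edge.\<close>

lemma segment_y_face:
  assumes j: "j \<in> Basis" and k: "k \<in> Basis"
  shows "closed_segment (y j) (y k) face_of truncation"
proof -
  define \<alpha> :: "'a \<Rightarrow> real" where "\<alpha> i = (if i = j \<or> i = k then 1 else 2)" for i
  txt \<open>On the truncation the functional \<open>h\<close> is maximal exactly on the segment, as it decreases twice
    as fast in the other directions.\<close>
  obtain h where h: "\<And>i. i \<in> Basis \<Longrightarrow> h \<bullet> (y i - v) = - \<alpha> i"
    using exists_functional_on_frame[of "\<lambda>i. y i - v" "\<lambda>i. - \<alpha> i", OF y_independent] by metis
  have hc: "h \<bullet> (v + (\<Sum>i\<in>Basis. c i *\<^sub>R (y i - v))) = h \<bullet> v - (\<Sum>i\<in>Basis. c i * \<alpha> i)" for c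
  proof -
    have "(\<Sum>i\<in>Basis. c i * (h \<bullet> (y i - v))) = (\<Sum>i\<in>Basis. - (c i * \<alpha> i))"
      by (rule sum.cong) (auto simp: h)
    then show ?thesis by (simp add: inner_add_right inner_sum_right sum_negf)
  qed
  have split: "(\<Sum>i\<in>Basis. c i * \<alpha> i) = (\<Sum>i\<in>Basis. c i) + (\<Sum>i\<in>Basis - {j, k}. c i)" for c
  proof -
    have "(\<Sum>i\<in>Basis. c i * \<alpha> i) = (\<Sum>i\<in>Basis. c i + (if i \<in> Basis - {j, k} then c i else 0))"
      by (rule sum.cong) (auto simp: \<alpha>_def)
    also have "\<dots> = (\<Sum>i\<in>Basis. c i) + (\<Sum>i\<in>Basis. if i \<in> Basis - {j, k} then c i else 0)"
      by (rule sum.distrib)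
    also have "(\<Sum>i\<in>Basis. if i \<in> Basis - {j, k} then c i else 0) = (\<Sum>i\<in>Basis - {j, k}. c i)"
      by (rule sum.mono_neutral_cong_right) auto
    finally show ?thesis .
  qed
  have le: "h \<bullet> x \<le> h \<bullet> v - 1" if x: "x \<in> truncation" for x
  proof -
    obtain c where c: "\<forall>i\<in>Basis. 0 \<le> c i" "x = v + (\<Sum>i\<in>Basis. c i *\<^sub>R (y i - v))"
      "(\<Sum>i\<in>Basis. c i) \<ge> 1" by (rule truncation_coords[OF x])
    have "h \<bullet> x = h \<bullet> v - (\<Sum>i\<in>Basis. c i * \<alpha> i)" unfolding c(2) by (rule hc)
    moreover have "(\<Sum>i\<in>Basis - {j, k}. c i) \<ge> 0" using c(1) by (intro sum_nonneg) auto
    ultimately show ?thesis using split[of c] c(3) by linarith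
  qed
  have hy: "h \<bullet> y i = h \<bullet> v - 1" if "i = j \<or> i = k" for i
    using h[of i] that j k by (auto simp: \<alpha>_def inner_diff_right)
  have "truncation \<inter> {x. h \<bullet> x = h \<bullet> v - 1} = closed_segment (y j) (y k)"
  proof
    show "closed_segment (y j) (y k) \<subseteq> truncation \<inter> {x. h \<bullet> x = h \<bullet> v - 1}"
      using y_in j k hy convex_truncation
      by (intro closed_segment_subset convex_Int convex_hyperplane) auto
    show "truncation \<inter> {x. h \<bullet> x = h \<bullet> v - 1} \<subseteq> closed_segment (y j) (y k)"
    proof
      fix x assume x: "x \<in> truncation \<inter> {x. h \<bullet> x = h \<bullet> v - 1}"
      obtain c where c: "\<forall>i\<in>Basis. 0 \<le> c i" "x = v + (\<Sum>i\<in>Basis. c i *\<^sub>R (y i - v))"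
        "(\<Sum>i\<in>Basis. c i) \<ge> 1" by (rule truncation_coords[OF IntD1[OF x]])
      have ge: "(\<Sum>i\<in>Basis - {j, k}. c i) \<ge> 0" using c(1) by (intro sum_nonneg) auto
      have "h \<bullet> x = h \<bullet> v - (\<Sum>i\<in>Basis. c i * \<alpha> i)" unfolding c(2) by (rule hc)
      then have "(\<Sum>i\<in>Basis. c i * \<alpha> i) = 1" using x by simp
      \<comment> \<open>By \<open>split\<close> the value 1 is the sum of a term that is at least 1
        and a term that is at least 0, so both are minimal.\<close>
      then have sum1: "(\<Sum>i\<in>Basis. c i) = 1" and sum0: "(\<Sum>i\<in>Basis - {j, k}. c i) = 0"
        using split[of c] ge c(3) by auto
      have zero: "\<forall>i\<in>Basis - {j, k}. c i = 0"
        using sum0 c(1) sum_nonneg_eq_0_iff[of "Basis - {j, k}" c] by simp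
      have jk: "{j, k} \<subseteq> Basis" using j k by simp
      have "(\<Sum>i\<in>{j, k}. c i) = 1"
        using sum.mono_neutral_right[OF finite_Basis jk zero] sum1 by simp
      moreover have "x = (\<Sum>i\<in>Basis. c i *\<^sub>R y i)"
        using c(2) sum1 by (simp add: scaleR_diff_right sum_subtractf flip: scaleR_sum_left)
      then have "x = (\<Sum>i\<in>{j, k}. c i *\<^sub>R y i)"
        using sum.mono_neutral_right[OF finite_Basis jk, of "\<lambda>i. c i *\<^sub>R y i"] zero by simp
      moreover have "(\<Sum>i\<in>{j, k}. c i *\<^sub>R y i) \<in> closed_segment (y j) (y k)"
        by (rule convex_sum) (use calculation c(1) jk in auto)
      ultimately show "x \<in> closed_segment (y j) (y k)" by simp
    qed
  qed
  then show ?thesis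
    using face_of_Int_supporting_hyperplane_le[OF convex_truncation, of h "h \<bullet> v - 1"] le by metis
qed

text \<open>The edges at \<open>y k\<close> are the rest of the old edge through it and the segments
  to the other \<open>y i\<close>.\<close>

lemma vertex_frame_new:
  assumes k: "k \<in> Basis"
  shows "vertex_frame truncation (y k) (\<lambda>i. if i = k then v + n k - y k else y i - y k)"
    (is "vertex_frame _ _ ?m")
proof -
  have mk: "v + n k - y k = ((1 - s k) / s k) *\<^sub>R (y k - v)"
    using s(1)[OF k] by (simp add: y_def scaleR_diff_left)
  have pos: "(1 - s k) / s k > 0" using s[OF k] by simp
  define r where "r = (1 - s k) / s k"
  have r: "r > 0" using pos by (simp add: r_def)
  \<comment> \<open>Base change to the vectors \<open>y i - v\<close>, using that
    \<open>y i - y k\<close> is the difference of two of them and that the old edge continues along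
    a positive multiple of \<open>y k - v\<close>.\<close>
  have split: "(\<Sum>i\<in>Basis. z i *\<^sub>R ?m i)
      = (\<Sum>i\<in>Basis. (if i = k then z k * r - (\<Sum>j\<in>Basis - {k}. z j) else z i) *\<^sub>R (y i - v))" for z
  proof -
    have "(\<Sum>i\<in>Basis. z i *\<^sub>R ?m i) = (z k * r) *\<^sub>R (y k - v) + (\<Sum>i\<in>Basis - {k}. z i *\<^sub>R (y i - y k))"
      using k by (simp add: sum.remove[OF finite_Basis k] mk r_def)
    also have "(\<Sum>i\<in>Basis - {k}. z i *\<^sub>R (y i - y k))
        = (\<Sum>i\<in>Basis - {k}. z i *\<^sub>R (y i - v) - z i *\<^sub>R (y k - v))"
      by (rule sum.cong) (auto simp: algebra_simps)
    also have "\<dots> = (\<Sum>i\<in>Basis - {k}. z i *\<^sub>R (y i - v)) - (\<Sum>i\<in>Basis - {k}. z i) *\<^sub>R (y k - v)"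
      by (simp add: sum_subtractf scaleR_sum_left)
    finally show ?thesis
      using k by (simp add: sum.remove[OF finite_Basis k] scaleR_diff_left)
  qed
  show ?thesis
    unfolding vertex_frame_def
  proof (intro conjI ballI allI impI)
    fix i :: 'a assume i: "i \<in> Basis"
    show "closed_segment (y k) (y k + ?m i) face_of truncation"
      using segment_y_face[OF k i] cut_face_face[OF cut_edge(1)[OF k, of False]] cut_edge(3)[OF k] by simp
  next
    fix z and i :: 'a assume "(\<Sum>i\<in>Basis. z i *\<^sub>R ?m i) = 0" and i: "i \<in> Basis"
    then have z: "\<forall>i\<in>Basis. (if i = k then z k * r - (\<Sum>j\<in>Basis - {k}. z j) else z i) = 0"
      unfolding split by (intro y_independent)
    then have "\<forall>j\<in>Basis - {k}. z j = 0" by (metis DiffE insertI1)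
    moreover from this have "z k * r = 0" using z k by auto
    then have "z k = 0" using pos unfolding r_def by (metis less_irrefl mult_eq_0_iff)
    ultimately show "z i = 0" using i by blast
  next
    fix x assume x: "x \<in> truncation"
    obtain c where c: "\<forall>i\<in>Basis. 0 \<le> c i" "x = v + (\<Sum>i\<in>Basis. c i *\<^sub>R (y i - v))"
      "(\<Sum>i\<in>Basis. c i) \<ge> 1" by (rule truncation_coords[OF x])
    \<comment> \<open>Solved from \<open>split\<close>, since \<open>x - y k\<close> has coordinate
      \<open>c k - 1\<close> at \<open>k\<close> and \<open>c i\<close> elsewhere. The entry at
      \<open>k\<close> is nonnegative exactly because the coordinates of a point of the truncation
      sum to at least 1.\<close>
    define z where "z i = (if i = k then ((\<Sum>i\<in>Basis. c i) - 1) / r else c i)" for i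
    have rest: "(\<Sum>j\<in>Basis - {k}. z j) = (\<Sum>j\<in>Basis. c j) - c k"
      using k by (simp add: sum.remove[OF finite_Basis k] z_def)
    have "(\<Sum>i\<in>Basis. z i *\<^sub>R ?m i) = (\<Sum>i\<in>Basis. (if i = k then c k - 1 else c i) *\<^sub>R (y i - v))"
      unfolding split by (rule sum.cong) (use r in \<open>auto simp only: rest, auto simp: z_def\<close>)
    also have "\<dots> = (\<Sum>i\<in>Basis. c i *\<^sub>R (y i - v)) - (y k - v)"
      using k by (simp add: sum.remove[OF finite_Basis k] algebra_simps)
    finally have "x = y k + (\<Sum>i\<in>Basis. z i *\<^sub>R ?m i)" using c(2) by simp
    moreover have "\<forall>i\<in>Basis. 0 \<le> z i" using c(1,3) r by (simp add: z_def)
    ultimately show "\<exists>z. (\<forall>i\<in>Basis. 0 \<le> z i) \<and> x = y k + (\<Sum>i\<in>Basis. z i *\<^sub>R ?m i)" by blast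
  qed
qed

text \<open>Only an edge running to \<open>v\<close> is affected, and it is merely
  shortened.\<close>

lemma vertex_frame_old:
  assumes w: "w extreme_point_of P" "w \<noteq> v" and m: "vertex_frame P w m"
  shows "\<exists>m'. vertex_frame truncation w m'"
proof -
  have aw: "a \<bullet> w < b" using below w by blast
  \<comment> \<open>The parameter at which the segment from \<open>w\<close> to \<open>v\<close>
    crosses the hyperplane.\<close>
  define t where "t = (b - a \<bullet> w) / (a \<bullet> v - a \<bullet> w)"
  have t: "0 < t" "t < 1" using aw above by (auto simp: t_def)
  define q where "q i = (if w + m i = v then t else 1)" for i
  have q: "0 < q i" for i using t by (simp add: q_def)
  have "closed_segment w (w + q i *\<^sub>R m i) face_of truncation" if i: "i \<in> Basis" for i
  proof -
    let ?E = "closed_segment w (w + m i)"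
    have E: "?E face_of P" using m i by (simp add: vertex_frame_def)
    have "?E \<noteq> {v}" using w(2) by auto
    then have idx: "(?E, False) \<in> cut_index" using E by (simp add: cut_index_def)
    have "cut_face (?E, False) = closed_segment w (w + q i *\<^sub>R m i)"
    proof (cases "w + m i = v")
      case True
      have seg: "?E = (\<lambda>r. w + r *\<^sub>R m i) ` {0..1}"
        using closed_segment_ray[of 0 1 w "m i"] by simp
      have seg': "closed_segment w (w + t *\<^sub>R m i) = (\<lambda>r. w + r *\<^sub>R m i) ` {0..t}"
        using closed_segment_ray[of 0 t w "m i"] t by simp
      have mi: "a \<bullet> m i = a \<bullet> v - a \<bullet> w" using True by (metis add_diff_cancel_left' inner_diff_right)
      have iff: "a \<bullet> (w + r *\<^sub>R m i) \<le> b \<longleftrightarrow> r \<le> t" for r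
        using aw above by (simp add: inner_add_right mi t_def pos_le_divide_eq algebra_simps)
      have "(\<lambda>r. w + r *\<^sub>R m i) ` {0..1} \<inter> {x. a \<bullet> x \<le> b} =
          (\<lambda>r. w + r *\<^sub>R m i) ` {r \<in> {0..1}. a \<bullet> (w + r *\<^sub>R m i) \<le> b}" by blast
      also have "{r \<in> {0..1}. a \<bullet> (w + r *\<^sub>R m i) \<le> b} = {0..t}"
        unfolding iff using t by auto
      finally show ?thesis unfolding seg'[symmetric] seg[symmetric] using True
        by (simp add: cut_face_def q_def)
    next
      case False
      have "v \<notin> ?E"
      proof
        assume "v \<in> ?E"
        then have "v extreme_point_of ?E" using extreme_point_of_face[OF E] vertex by blast
        then show False using extreme_point_of_segment w(2) False by metis
      qed
      then have "?E \<subseteq> {x. a \<bullet> x \<le> b}" using face_below[OF E] by (auto intro: less_imp_le)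
      then show ?thesis using False by (simp add: cut_face_def q_def Int_absorb2)
    qed
    then show ?thesis using cut_face_face[OF idx] by simp
  qed
  then have "vertex_frame truncation w (\<lambda>i. q i *\<^sub>R m i)"
    by (intro vertex_frame_scale[OF m]) (use q in \<open>auto simp: truncation_def\<close>)
  then show ?thesis by blast
qed

lemma simple_truncation:
  assumes "simple_polytope P" shows "simple_polytope truncation"
  unfolding simple_polytope_def
proof (intro conjI allI impI polytope_truncation)
  fix x assume "x extreme_point_of truncation"
  then show "\<exists>m. vertex_frame truncation x m"
  proof (cases rule: extreme_point_of_truncation_cases)
    case 1
    then show ?thesis using assms vertex_frame_old unfolding simple_polytope_def by blast
  next
    case (2 i)
    then show ?thesis using vertex_frame_new by blast
  qed
qed

end

text \<open>The functional with \<open>a \<bullet> n i = - (1 / \<sigma> i)\<close> drops by exactly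
  1 from \<open>v\<close> to each prescribed point, so one hyperplane contains them all. A further
  vertex on or above it would lie in the convex hull of \<open>v\<close> and these points, hence be
  one of them; but they lie inside edges and are not extreme.\<close>

lemma exists_framed_cut:
  fixes P :: "'a::euclidean_space set"
  assumes P: "polytope P" and v: "v extreme_point_of P" and n: "vertex_frame P v n"
    and \<sigma>: "\<And>i. i \<in> Basis \<Longrightarrow> 0 < \<sigma> i \<and> \<sigma> i < 1"
  obtains a b where "framed_cut P v a b n"
    "\<And>i. i \<in> Basis \<Longrightarrow> framed_cut.y v a b n i = v + \<sigma> i *\<^sub>R n i"
proof -
  obtain a where a: "\<And>i. i \<in> Basis \<Longrightarrow> a \<bullet> n i = - (1 / \<sigma> i)"
    using exists_functional_on_frame[of n "\<lambda>i. - (1 / \<sigma> i)", OF vertex_frame_independent[OF n]] by metis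
  let ?b = "a \<bullet> v - 1"
  let ?y = "\<lambda>i. v + \<sigma> i *\<^sub>R n i"
  have edge: "closed_segment v (v + n i) face_of P" if "i \<in> Basis" for i
    using n that unfolding vertex_frame_def by blast
  have inP: "v \<in> P" "v + n i \<in> P" if "i \<in> Basis" for i
    using face_of_imp_subset[OF edge[OF that]] by auto
  have yopen: "?y i \<in> open_segment v (v + n i)" if i: "i \<in> Basis" for i
  proof -
    have "n i \<noteq> 0" using a[OF i] \<sigma>[OF i] by auto
    moreover have "?y i = (1 - \<sigma> i) *\<^sub>R v + \<sigma> i *\<^sub>R (v + n i)" by (simp add: algebra_simps)
    ultimately show ?thesis using \<sigma>[OF i] unfolding in_segment by auto
  qed
  have yP: "?y i \<in> P" if "i \<in> Basis" for i
    using yopen[OF that] inP[OF that] polytope_imp_convex[OF P]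
    by (meson convex_contains_open_segment subset_iff)
  have "a \<bullet> w < ?b" if w: "w extreme_point_of P" "w \<noteq> v" for w
  proof (rule ccontr)
    assume neg: "\<not> a \<bullet> w < ?b"
    have "w \<in> P" using w by (simp add: extreme_point_of_def)
    then obtain z where z: "\<forall>i\<in>Basis. 0 \<le> z i" "w = v + (\<Sum>i\<in>Basis. z i *\<^sub>R n i)"
      using n unfolding vertex_frame_def by blast
    define c where "c i = z i / \<sigma> i" for i
    have c0: "\<forall>i\<in>Basis. 0 \<le> c i" using z(1) \<sigma> by (auto simp: c_def less_imp_le)
    have "(\<Sum>i\<in>Basis. z i * (a \<bullet> n i)) = (\<Sum>i\<in>Basis. - c i)"
      by (rule sum.cong) (auto simp: a c_def)
    then have "a \<bullet> w = a \<bullet> v - (\<Sum>i\<in>Basis. c i)"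
      unfolding z(2) by (simp add: inner_add_right inner_sum_right sum_negf)
    then have c1: "(\<Sum>i\<in>Basis. c i) \<le> 1" using neg by linarith
    have wc: "w = v + (\<Sum>i\<in>Basis. c i *\<^sub>R (?y i - v))"
      unfolding z(2) by (intro arg_cong2[where f="(+)"] refl sum.cong) (use \<sigma> in \<open>force simp: c_def\<close>)+
    \<comment> \<open>The index 0, not a basis vector, stands for \<open>v\<close>, which takes the
      remaining weight of the convex combination.\<close>
    have J0: "(0::'a) \<notin> Basis" by simp
    let ?\<mu> = "\<lambda>i. if i = 0 then 1 - (\<Sum>i\<in>Basis. c i) else c i"
    let ?p = "\<lambda>i. if i = 0 then v else ?y i"
    have b0: "(\<Sum>i\<in>Basis. ?\<mu> i) = (\<Sum>i\<in>Basis. c i)" by (rule sum.cong) auto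
    have b1: "(\<Sum>i\<in>Basis. ?\<mu> i *\<^sub>R ?p i) = (\<Sum>i\<in>Basis. c i *\<^sub>R ?y i)" by (rule sum.cong) auto
    have "(\<Sum>i\<in>insert 0 Basis. ?\<mu> i *\<^sub>R ?p i) \<in> convex hull (insert v (?y ` Basis))"
      by (rule convex_sum) (use c0 c1 b0 in \<open>auto intro: hull_inc\<close>)
    moreover have "(\<Sum>i\<in>insert 0 Basis. ?\<mu> i *\<^sub>R ?p i) = w"
      unfolding sum.insert[OF finite_Basis J0] b1 wc
      by (simp only: scaleR_diff_right sum_subtractf scaleR_sum_left[symmetric] if_True)
        (simp add: algebra_simps)
    ultimately have "w \<in> convex hull (insert v (?y ` Basis))" by simp
    moreover have "convex hull (insert v (?y ` Basis)) \<subseteq> P"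
      using inP(1)[OF SOME_Basis] yP polytope_imp_convex[OF P] by (intro hull_minimal) auto
    ultimately have "w extreme_point_of convex hull (insert v (?y ` Basis))"
      using extreme_point_of_subset w(1) by blast
    then have "w \<in> insert v (?y ` Basis)" by (rule extreme_point_of_convex_hull)
    then obtain i where i: "i \<in> Basis" "w = ?y i" using w(2) by blast
    then show False using w(1) yopen[OF i(1)] inP[OF i(1)] unfolding extreme_point_of_def by blast
  qed
  then have fc: "framed_cut P v a ?b n"
    unfolding framed_cut_def framed_cut_axioms_def vertex_cut_def using P v n by simp
  moreover have "framed_cut.y v a ?b n i = ?y i" if "i \<in> Basis" for i
    using a[OF that] \<sigma>[OF that] by (simp add: framed_cut.y_def[OF fc] framed_cut.s_def[OF fc])
  ultimately show thesis by (rule that)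
qed

lemma frame_directions_independent:
  assumes n: "vertex_frame P v n" and ij: "i \<in> Basis" "j \<in> Basis" "i \<noteq> j"
    and eq: "\<alpha> *\<^sub>R n i = \<beta> *\<^sub>R n j"
  shows "\<alpha> = 0"
proof -
  define z where "z l = (if l = i then \<alpha> else 0) - (if l = j then \<beta> else 0)" for l
  have "(\<Sum>l\<in>Basis. z l *\<^sub>R n l) = (\<Sum>l\<in>Basis. (if l = i then \<alpha> *\<^sub>R n i else 0) - (if l = j then \<beta> *\<^sub>R n j else 0))"
    by (rule sum.cong) (auto simp: z_def scaleR_diff_left)
  also have "\<dots> = 0" using ij eq by (simp add: sum_subtractf)
  finally have "\<forall>l\<in>Basis. z l = 0" by (rule vertex_frame_independent[OF n])
  then show ?thesis using ij by (auto simp: z_def)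
qed

section \<open>Convex bodies\<close>

text \<open>If the farther point were in \<open>K\<close>, shrinking towards the interior point
  \<open>p\<close> would put the frontier point into the interior.\<close>

lemma outside_beyond_frontier:
  fixes K :: "'a::euclidean_space set"
  assumes K: "convex K" and p: "p \<in> interior K"
    and fr: "p + d *\<^sub>R l \<in> frontier K" and d: "0 < d" "d < e"
  shows "p + e *\<^sub>R l \<notin> K"
proof
  assume "p + e *\<^sub>R l \<in> K"
  then have "p + e *\<^sub>R l - (1 - d / e) *\<^sub>R (p + e *\<^sub>R l - p) \<in> interior K"
    using d closure_subset by (intro mem_interior_closure_convex_shrink[OF K p]) auto
  moreover have "p + e *\<^sub>R l - (1 - d / e) *\<^sub>R (p + e *\<^sub>R l - p) = p + d *\<^sub>R l"
    using d by (simp add: algebra_simps)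
  ultimately have "p + d *\<^sub>R l \<in> interior K" by (simp only:)
  then show False using fr by (simp add: frontier_def)
qed

text \<open>From an interior point at parameter \<open>\<tau>\<close> go back towards
  \<open>v\<close> until the frontier is reached after a length \<open>d\<close>; then
  \<open>\<sigma> = \<tau> - d\<close>. This happens before \<open>v\<close>, which is outside
  \<open>K\<close>.\<close>

lemma segment_enters_body:
  fixes K :: "'a::euclidean_space set"
  assumes K: "compact K" "convex K" and v: "v \<notin> K" and w: "v + n \<notin> interior K"
    and meet: "closed_segment v (v + n) \<inter> interior K \<noteq> {}"
  obtains \<sigma> \<tau> where "0 < \<sigma>" "\<sigma> < \<tau>" "\<tau> < 1" "v + \<sigma> *\<^sub>R n \<in> frontier K" "v + \<tau> *\<^sub>R n \<in> interior K"
    "\<And>r. r < \<sigma> \<Longrightarrow> v + r *\<^sub>R n \<notin> K"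
proof -
  have "closed_segment v (v + n) = (\<lambda>r. v + r *\<^sub>R n) ` {0..1}"
    using closed_segment_ray[of 0 1 v n] by simp
  then obtain \<tau> where \<tau>: "0 \<le> \<tau>" "\<tau> \<le> 1" "v + \<tau> *\<^sub>R n \<in> interior K" using meet by auto
  have "\<tau> \<noteq> 1" using \<tau>(3) w by auto
  have "n \<noteq> 0" using \<tau>(3) w by auto
  then obtain d where d: "0 < d" "v + \<tau> *\<^sub>R n + d *\<^sub>R (- n) \<in> frontier K"
    "\<And>e. \<lbrakk>0 \<le> e; e < d\<rbrakk> \<Longrightarrow> v + \<tau> *\<^sub>R n + e *\<^sub>R (- n) \<in> interior K"
    using ray_to_frontier[OF compact_imp_bounded[OF K(1)] \<tau>(3), of "- n"] by (metis neg_equal_0_iff_equal)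
  have "frontier K \<subseteq> K" using K(1) compact_imp_closed frontier_subset_closed by blast
  have "d < \<tau>"
  proof (rule ccontr)
    assume "\<not> d < \<tau>"
    then consider "\<tau> = d" | "\<tau> < d" by linarith
    then show False
    proof cases
      case 1
      then show False using d(2) v \<open>frontier K \<subseteq> K\<close> by auto
    next
      case 2
      then show False using d(3)[OF \<tau>(1)] v interior_subset by auto
    qed
  qed
  show thesis
  proof (rule that[of "\<tau> - d" \<tau>])
    fix r assume "r < \<tau> - d"
    then have "v + \<tau> *\<^sub>R n + (\<tau> - r) *\<^sub>R (- n) \<notin> K"
      by (intro outside_beyond_frontier[OF K(2) \<tau>(3) d(2,1)]) simp
    then show "v + r *\<^sub>R n \<notin> K" by (simp add: algebra_simps)
  qed (use d \<tau> \<open>d < \<tau>\<close> \<open>\<tau> \<noteq> 1\<close> in \<open>auto simp: algebra_simps\<close>)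
qed

text \<open>For each pair, fix the ratio \<open>u\<close> of a point of the segment in
  \<open>U\<close>. The point with this ratio moves continuously with \<open>t\<close>, so it stays
  in \<open>U\<close> for small \<open>t\<close>, and finitely many pairs admit a common
  \<open>t\<close>.\<close>

lemma perturbed_segments_meet_open:
  fixes e m :: "'i \<Rightarrow> 'a::real_normed_vector"
  assumes "finite I" "open U"
    and meet: "\<And>i j. \<lbrakk>i \<in> I; j \<in> I; i \<noteq> j\<rbrakk> \<Longrightarrow> closed_segment (e i) (e j) \<inter> U \<noteq> {}"
  obtains t :: real where "0 < t" "t < 1"
    "\<And>i j. \<lbrakk>i \<in> I; j \<in> I; i \<noteq> j\<rbrakk> \<Longrightarrow>
       closed_segment (e i + t *\<^sub>R m i) (e j + t *\<^sub>R m j) \<inter> U \<noteq> {}"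
proof -
  let ?Q = "\<lambda>i j t. i \<noteq> j \<longrightarrow> closed_segment (e i + t *\<^sub>R m i) (e j + t *\<^sub>R m j) \<inter> U \<noteq> {}"
  have "\<forall>\<^sub>F t in at_right 0. ?Q i j t" if ij: "i \<in> I" "j \<in> I" for i j
  proof (cases "i = j")
    case False
    then obtain u where u: "0 \<le> u" "u \<le> 1" "(1 - u) *\<^sub>R e i + u *\<^sub>R e j \<in> U"
      using meet[OF ij] by (auto simp: in_segment)
    have "((\<lambda>t. (1 - u) *\<^sub>R (e i + t *\<^sub>R m i) + u *\<^sub>R (e j + t *\<^sub>R m j)) \<longlongrightarrow>
        (1 - u) *\<^sub>R (e i + 0 *\<^sub>R m i) + u *\<^sub>R (e j + 0 *\<^sub>R m j)) (at_right 0)"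
      by (intro tendsto_intros)
    then have "\<forall>\<^sub>F t in at_right 0. (1 - u) *\<^sub>R (e i + t *\<^sub>R m i) + u *\<^sub>R (e j + t *\<^sub>R m j) \<in> U"
      by (rule topological_tendstoD) (use u \<open>open U\<close> in simp_all)
    then show ?thesis
    proof (rule eventually_mono)
      fix t assume "(1 - u) *\<^sub>R (e i + t *\<^sub>R m i) + u *\<^sub>R (e j + t *\<^sub>R m j) \<in> U"
      moreover have "(1 - u) *\<^sub>R (e i + t *\<^sub>R m i) + u *\<^sub>R (e j + t *\<^sub>R m j)
          \<in> closed_segment (e i + t *\<^sub>R m i) (e j + t *\<^sub>R m j)"
        unfolding in_segment using u(1,2) by blast
      ultimately show "?Q i j t" by blast
    qed
  qed simp
  then have "\<forall>\<^sub>F t in at_right 0. \<forall>i\<in>I. \<forall>j\<in>I. ?Q i j t"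
    by (intro eventually_ball_finite[OF \<open>finite I\<close>] ballI) 
  moreover have "\<forall>\<^sub>F t in at_right (0::real). 0 < t \<and> t < 1"
    by (rule eventually_at_rightI[of 0 1]) auto
  ultimately have "\<forall>\<^sub>F t in at_right (0::real). (0 < t \<and> t < 1) \<and> (\<forall>i\<in>I. \<forall>j\<in>I. ?Q i j t)"
    by (rule eventually_conj[rotated])
  then have "\<exists>t. (0 < t \<and> t < 1) \<and> (\<forall>i\<in>I. \<forall>j\<in>I. ?Q i j t)"
    by (rule eventually_happens'[OF trivial_limit_at_right_real])
  then obtain t where t: "0 < t" "t < 1" "\<forall>i\<in>I. \<forall>j\<in>I. ?Q i j t" by blast
  show thesis by (rule that[OF t(1,2)]) (use t(3) in blast)
qed

section \<open>Simplices\<close>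

lemma convex_hull_affine_independent_Int:
  assumes "\<not> affine_dependent A" "c \<subseteq> A"
  shows "(convex hull c) \<inter> A = c"
proof
  show "(convex hull c) \<inter> A \<subseteq> c"
  proof
    fix x assume x: "x \<in> (convex hull c) \<inter> A"
    show "x \<in> c"
    proof (rule ccontr)
      assume "x \<notin> c"
      then have "convex hull c \<subseteq> affine hull (A - {x})"
        using assms(2) hull_mono[of c "A - {x}" affine] convex_hull_subset_affine_hull[of c] by blast
      then show False using x assms(1) unfolding affine_dependent_def by blast
    qed
  qed
  show "c \<subseteq> (convex hull c) \<inter> A" using assms(2) hull_subset[of c convex] by simp
qed

text \<open>Faces of a simplex are the hulls of arbitrary vertex subsets, and each face determines
  its subset, so every bijection of vertices induces an isomorphism.\<close>

lemma face_iso_simplex: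
  fixes U :: "'a::euclidean_space set" and A :: "'b::euclidean_space set"
  assumes U: "\<not> affine_dependent U" and A: "\<not> affine_dependent A" and k: "bij_betw k U A"
  shows "face_iso (\<lambda>F. convex hull (k ` (F \<inter> U))) (convex hull U) (convex hull A)"
proof (rule face_isoI)
  have faceU: "\<exists>c\<subseteq>U. F = convex hull c \<and> F \<inter> U = c" if "F face_of convex hull U" for F
    using that face_of_convex_hull_affine_independent[OF U] convex_hull_affine_independent_Int[OF U]
    by metis
  have im: "k ` c \<subseteq> A" if "c \<subseteq> U" for c using k that by (auto simp: bij_betw_def)
  show "convex hull (k ` (F \<inter> U)) face_of convex hull A" if "F face_of convex hull U" for F
    using face_of_convex_hull_affine_independent[OF A] im[of "F \<inter> U"] by blast
  show "convex hull (k ` (F \<inter> U)) \<subseteq> convex hull (k ` (F' \<inter> U)) \<longleftrightarrow> F \<subseteq> F'"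
    if F: "F face_of convex hull U" "F' face_of convex hull U" for F F'
  proof -
    obtain c c' where c: "c \<subseteq> U" "F = convex hull c" "F \<inter> U = c"
      and c': "c' \<subseteq> U" "F' = convex hull c'" "F' \<inter> U = c'" using faceU F by metis
    have "convex hull (k ` c) \<subseteq> convex hull (k ` c') \<longleftrightarrow> k ` c \<subseteq> k ` c'"
      using hull_mono convex_hull_affine_independent_Int[OF A im[OF c(1)]]
        convex_hull_affine_independent_Int[OF A im[OF c'(1)]] by blast
    also have "\<dots> \<longleftrightarrow> c \<subseteq> c'"
      using k c(1) c'(1) inj_on_image_subset_iff[of k U c c'] by (simp add: bij_betw_def)
    also have "\<dots> \<longleftrightarrow> F \<subseteq> F'" using c c' hull_mono by blast
    finally show ?thesis using c(3) c'(3) by simp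
  qed
  fix G assume "G face_of convex hull A"
  then obtain c where c: "c \<subseteq> A" "G = convex hull c"
    using face_of_convex_hull_affine_independent[OF A] by blast
  then obtain c' where c': "c' \<subseteq> U" "k ` c' = c" using k by (metis bij_betw_def subset_imageE)
  then have "convex hull c' face_of convex hull U" "convex hull (k ` ((convex hull c') \<inter> U)) = G"
    using face_of_convex_hull_affine_independent[OF U] convex_hull_affine_independent_Int[OF U c'(1)] c(2)
    by auto
  then show "\<exists>F. F face_of convex hull U \<and> convex hull (k ` (F \<inter> U)) = G" by blast
qed

lemma simple_simplex:
  fixes U :: "'a::euclidean_space set"
  assumes U: "\<not> affine_dependent U" and card: "card U = DIM('a) + 1"
  shows "simple_polytope (convex hull U)"
  unfolding simple_polytope_def
proof (intro conjI allI impI)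
  have fin: "finite U" using U by (rule aff_independent_finite)
  then show "polytope (convex hull U)" by (rule polytope_convex_hull)
  fix v assume "v extreme_point_of convex hull U"
  then have v: "v \<in> U" by (rule extreme_point_of_convex_hull)
  have "card (Basis :: 'a set) = card (U - {v})" using card v fin by simp
  then obtain \<beta> where \<beta>: "bij_betw \<beta> (Basis :: 'a set) (U - {v})"
    using fin finite_same_card_bij[OF finite_Basis, of "U - {v}"] by auto
  have \<beta>U: "\<beta> i \<in> U" "\<beta> i \<noteq> v" if "i \<in> Basis" for i using bij_betwE[OF \<beta>] that by auto
  have split: "(\<Sum>u\<in>U. g u) = g v + (\<Sum>i\<in>Basis. g (\<beta> i))" for g :: "'a \<Rightarrow> 'c::comm_monoid_add"
    using sum.reindex_bij_betw[OF \<beta>, of g] sum.remove[OF fin v, of g] by simp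
  have "vertex_frame (convex hull U) v (\<lambda>i. \<beta> i - v)"
    unfolding vertex_frame_def
  proof (intro conjI ballI allI impI)
    fix i :: 'a assume "i \<in> Basis"
    then have "{v, \<beta> i} \<subseteq> U" using v \<beta>U by blast
    then show "closed_segment v (v + (\<beta> i - v)) face_of convex hull U"
      using face_of_convex_hull_affine_independent[OF U] unfolding segment_convex_hull
      by (metis add_diff_cancel_left' add.commute diff_add_cancel)
  next
    fix z and i :: 'a assume 0: "(\<Sum>i\<in>Basis. z i *\<^sub>R (\<beta> i - v)) = 0" and i: "i \<in> Basis"
    \<comment> \<open>Extends \<open>z\<close> to an affine dependence of \<open>U\<close>; the
      coefficient at \<open>v\<close> makes the total zero.\<close>
    define l where "l u = (if u = v then - (\<Sum>i\<in>Basis. z i) else z (inv_into Basis \<beta> u))" for u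
    have l\<beta>: "l (\<beta> j) = z j" if "j \<in> Basis" for j
      using \<beta>U(2)[OF that] bij_betw_inv_into_left[OF \<beta> that] by (simp add: l_def)
    have sl: "(\<Sum>i\<in>Basis. l (\<beta> i)) = (\<Sum>i\<in>Basis. z i)"
      "(\<Sum>i\<in>Basis. l (\<beta> i) *\<^sub>R \<beta> i) = (\<Sum>i\<in>Basis. z i *\<^sub>R \<beta> i)"
      by (rule sum.cong; simp add: l\<beta>)+
    have "(\<Sum>u\<in>U. l u) = 0" unfolding split sl by (simp add: l_def)
    moreover have "(\<Sum>u\<in>U. l u *\<^sub>R u) = 0"
      using 0 unfolding split sl
      by (simp add: l_def scaleR_diff_right sum_subtractf flip: scaleR_sum_left)
    ultimately have "\<forall>u\<in>U. l u = 0"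
      using U affine_dependent_explicit_finite[OF fin] by blast
    then show "z i = 0" using l\<beta>[OF i] \<beta>U(1)[OF i] by simp
  next
    fix x assume "x \<in> convex hull U"
    then obtain l where l: "\<forall>u\<in>U. 0 \<le> l u" "(\<Sum>u\<in>U. l u) = 1" "(\<Sum>u\<in>U. l u *\<^sub>R u) = x"
      by (auto simp: convex_hull_finite[OF fin])
    \<comment> \<open>Eliminating the barycentric coordinate of \<open>v\<close> leaves those of the
      other vertices as coordinates in the frame.\<close>
    have lv: "l v = 1 - (\<Sum>i\<in>Basis. l (\<beta> i))" using l(2) unfolding split by linarith
    have "x = l v *\<^sub>R v + (\<Sum>i\<in>Basis. l (\<beta> i) *\<^sub>R \<beta> i)" using l(3) unfolding split by simp
    then have "x = v + (\<Sum>i\<in>Basis. l (\<beta> i) *\<^sub>R (\<beta> i - v))"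
      unfolding lv by (simp add: scaleR_diff_right scaleR_diff_left sum_subtractf flip: scaleR_sum_left)
    then show "\<exists>z. (\<forall>i\<in>Basis. 0 \<le> z i) \<and> x = v + (\<Sum>i\<in>Basis. z i *\<^sub>R (\<beta> i - v))"
      using l(1) \<beta>U(1) by (intro exI[of _ "\<lambda>i. l (\<beta> i)"]) simp
  qed
  then show "\<exists>n. vertex_frame (convex hull U) v n" by blast
qed

lemma affine_independent_family:
  fixes u :: "'i \<Rightarrow> 'a::real_vector"
  assumes fin: "finite J"
    and ind: "\<And>\<mu>. \<lbrakk>(\<Sum>j\<in>J. \<mu> j) = 0; (\<Sum>j\<in>J. \<mu> j *\<^sub>R u j) = 0\<rbrakk> \<Longrightarrow> \<forall>j\<in>J. \<mu> j = (0::real)"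
  shows "inj_on u J" "\<not> affine_dependent (u ` J)"
proof -
  show inj: "inj_on u J"
  proof (rule inj_onI, rule ccontr)
    fix i j assume ij: "i \<in> J" "j \<in> J" "u i = u j" "i \<noteq> j"
    let ?\<mu> = "\<lambda>l. (if l = i then 1 else 0) - (if l = j then 1 else (0::real))"
    have "(\<Sum>l\<in>J. ?\<mu> l) = 0" using ij fin by (simp add: sum_subtractf)
    moreover have "(\<Sum>l\<in>J. ?\<mu> l *\<^sub>R u l) = (\<Sum>l\<in>J. (if l = i then u i else 0) - (if l = j then u j else 0))"
      by (rule sum.cong) auto
    then have "(\<Sum>l\<in>J. ?\<mu> l *\<^sub>R u l) = 0" using ij fin by (simp add: sum_subtractf)
    ultimately have "\<forall>l\<in>J. ?\<mu> l = 0" by (rule ind)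
    then show False using ij by (metis diff_zero zero_neq_one)
  qed
  show "\<not> affine_dependent (u ` J)"
  proof
    assume "affine_dependent (u ` J)"
    then obtain l where l: "sum l (u ` J) = 0" "\<exists>v\<in>u ` J. l v \<noteq> 0" "(\<Sum>v\<in>u ` J. l v *\<^sub>R v) = 0"
      using affine_dependent_explicit_finite[of "u ` J"] fin by auto
    then have "\<forall>j\<in>J. l (u j) = 0"
      by (intro ind) (simp_all add: sum.reindex[OF inj])
    then show False using l(2) by blast
  qed
qed

section \<open>Partially inscribed realisations\<close>

lemma segment_meets_interior:
  assumes K: "smooth_strictly_convex_body K" and xy: "x \<in> frontier K" "y \<in> frontier K" "x \<noteq> y"
  shows "closed_segment x y \<inter> interior K \<noteq> {}"
proof -
  have "closed K" "convex K" and strict: "\<not> closed_segment x y \<subseteq> frontier K"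
    using K xy(3) by (auto simp: smooth_strictly_convex_body_def convex_body_def compact_imp_closed)
  then have "frontier K \<subseteq> K" by (simp add: frontier_subset_closed)
  then have "closed_segment x y \<subseteq> K" using xy \<open>convex K\<close> by (intro closed_segment_subset) auto
  moreover have "K - frontier K \<subseteq> interior K"
    using closure_subset by (auto simp: frontier_def)
  ultimately show ?thesis using strict by blast
qed

text \<open>\<^term>\<open>R\<close> realises the face lattice of \<^term>\<open>Q\<close>; its vertices that correspond to faces in
  \<^term>\<open>S\<close> lie on the boundary of \<^term>\<open>K\<close> and all others outside of \<^term>\<open>K\<close>.  The vertices
  outside are the ones that can still be truncated.\<close>

definition partially_inscribed ::
    "'a::euclidean_space set \<Rightarrow> 'b::euclidean_space set set \<Rightarrow> 'a set \<Rightarrow> ('a set \<Rightarrow> 'b set) \<Rightarrow> 'b set \<Rightarrow> bool"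
  where "partially_inscribed K S R f Q \<longleftrightarrow>
    simple_polytope R \<and> face_iso f R Q \<and>
    (\<forall>x. x extreme_point_of R \<longrightarrow> (if f {x} \<in> S then x \<in> frontier K else x \<notin> K)) \<and>
    (\<forall>x y. x \<noteq> y \<longrightarrow> closed_segment x y face_of R \<longrightarrow> closed_segment x y \<inter> interior K \<noteq> {})"

context framed_cut
begin

text \<open>The cases follow the ends of the edge: two old vertices, one old and one new, or two new
  ones. In the mixed case the edge is what remains of an edge at \<open>v\<close>.\<close>

lemma edge_of_truncation_cases:
  assumes xy: "x \<noteq> x'" and face: "closed_segment x x' face_of truncation"
  obtains "closed_segment x x' face_of P"
  | i where "i \<in> Basis" "closed_segment x x' = closed_segment (v + n i) (y i)"
  | i j where "i \<in> Basis" "j \<in> Basis" "x = y i" "x' = y j"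
proof -
  obtain F c where F: "(F, c) \<in> cut_index" "closed_segment x x' = cut_face (F, c)"
    using face by (rule cut_face_cases)
  have FP: "F face_of P" "F \<noteq> {v}" using F(1) by (auto simp: cut_index_def)
  have sub: "closed_segment x x' \<subseteq> F" using F(2) by (auto simp: cut_face_def)
  \<comment> \<open>\<open>F\<close> contains the point \<open>y i\<close> of the open edge at
    \<open>v\<close>, hence also \<open>v + n i\<close>. As a vertex of the truncation this must be
    an end of the segment, and it is not \<open>y i\<close>, so it is \<open>z\<close>.\<close>
  have mixed: "closed_segment z (y i) = closed_segment (v + n i) (y i)"
    if z: "a \<bullet> z < b" and i: "i \<in> Basis" and eq: "closed_segment x x' = closed_segment z (y i)" for z i
  proof -
    have "z \<in> cut_face (F, c)" using F(2) eq by (metis ends_in_segment(1))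
    then have "\<not> c" using z by (auto simp: cut_face_def)
    have "y i \<in> F" using sub eq by auto
    have "y i = (1 - s i) *\<^sub>R v + s i *\<^sub>R (v + n i)" by (simp add: y_def algebra_simps)
    then have "y i \<in> open_segment v (v + n i)"
      using s(1,2)[OF i] n_nonzero[OF i] unfolding in_segment by auto
    moreover have "v \<in> P" "v + n i \<in> P" using face_of_imp_subset[OF edge[OF i]] by auto
    ultimately have "v + n i \<in> F" using face_ofD[OF FP(1)] \<open>y i \<in> F\<close> by blast
    then have "v + n i \<in> cut_face (F, c)"
      using n_below[OF i] \<open>\<not> c\<close> by (simp add: cut_face_def less_imp_le)
    then have w: "v + n i \<in> closed_segment z (y i)" using F(2) eq by simp
    have wt: "v + n i \<in> truncation"
      using n_below[OF i] \<open>v + n i \<in> P\<close> by (simp add: truncation_def less_imp_le)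
    have "v + n i extreme_point_of truncation"
      by (rule extreme_point_of_subset[OF extreme_point_of_segment_face(2)[OF edge[OF i]] _ wt])
        (simp add: truncation_def)
    then have "v + n i extreme_point_of closed_segment z (y i)"
      using extreme_point_of_face[OF face[unfolded eq]] w by blast
    then have "v + n i = z \<or> v + n i = y i" using extreme_point_of_segment by blast
    then show ?thesis using n_below[OF i] y_on[OF i] by auto
  qed
  have ends: "x extreme_point_of truncation" "x' extreme_point_of truncation"
    using extreme_point_of_segment_face[OF face] .
  show thesis
  proof (cases rule: extreme_point_of_truncation_cases[OF ends(1)])
    case x: 1
    show thesis
    proof (cases rule: extreme_point_of_truncation_cases[OF ends(2)])
      case x': 1
      have lt: "closed_segment x x' \<subseteq> {z. a \<bullet> z < b}"
        using x(3) x'(3) by (intro closed_segment_subset convex_halfspace_lt) auto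
      \<comment> \<open>With \<open>v\<close> in it, \<open>F\<close> would meet the hyperplane, but
        the segment lies strictly below.\<close>
      have "v \<notin> F"
      proof
        assume "v \<in> F"
        then obtain p where p: "p \<in> rel_interior F" "a \<bullet> p = b" using face_meets_hyperplane FP by metis
        then have "p \<in> cut_face (F, c)" using rel_interior_subset by (auto simp: cut_face_def)
        then show False using p(2) lt F(2) by auto
      qed
      then have "\<not> c" using F(1) by (auto simp: cut_index_def)
      have "F \<subseteq> {z. a \<bullet> z \<le> b}" using face_below[OF FP(1) \<open>v \<notin> F\<close>] by (auto intro: less_imp_le)
      then have "F = closed_segment x x'" using F(2) \<open>\<not> c\<close> by (auto simp: cut_face_def)
      then show thesis using that(1) FP(1) by blast
    next
      case (2 i)
      then show thesis using mixed[OF x(3) 2(1)] that(2) by simp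
    qed
  next
    case x: (2 i)
    show thesis
    proof (cases rule: extreme_point_of_truncation_cases[OF ends(2)])
      case 1
      then show thesis using mixed[OF 1(3) x(1)] that(2)[OF x(1)] x(2) closed_segment_commute by metis
    next
      case (2 j)
      then show thesis using that(3) x by blast
    qed
  qed
qed

end

text \<open>Dropping \<open>{v}\<close> from the labels puts the vertex realising \<open>v\<close>
  outside \<open>K\<close>, whatever \<open>S\<close> says. All other old vertices keep their
  labels.\<close>

lemma partially_inscribed_truncation:
  fixes K :: "'a::euclidean_space set" and Q :: "'b::euclidean_space set"
  assumes K: "smooth_strictly_convex_body K"
    and Q: "vertex_cut Q v a b"
    and R: "partially_inscribed K (S - {{v}}) R f Q"
  shows "\<exists>R' f'. partially_inscribed K S R' f' (Q \<inter> {x. a \<bullet> x \<le> b})"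
proof -
  interpret Q: vertex_cut Q v a b by fact
  have cK: "compact K" "convex K"
    using K by (auto simp: smooth_strictly_convex_body_def convex_body_def)
  have simple: "simple_polytope R" and iso: "face_iso f R Q"
    and label: "\<And>x. x extreme_point_of R \<Longrightarrow> if f {x} \<in> S - {{v}} then x \<in> frontier K else x \<notin> K"
    and edges: "\<And>x y. \<lbrakk>x \<noteq> y; closed_segment x y face_of R\<rbrakk> \<Longrightarrow> closed_segment x y \<inter> interior K \<noteq> {}"
    using R unfolding partially_inscribed_def by blast+
  have polyR: "polytope R" using simple by (simp add: simple_polytope_def)
  obtain w where w: "w extreme_point_of R" "f {w} = {v}"
    using face_iso_vertex_preimage[OF iso polyR Q.vertex] by blast
  have "w \<notin> K" using label[OF w(1)] w(2) by simp
  obtain n where n: "vertex_frame R w n" using simple w(1) by (auto simp: simple_polytope_def)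
  define E where "E i = closed_segment w (w + n i)" for i
  have E: "E i face_of R" if "i \<in> Basis" for i
    using n that by (simp add: vertex_frame_def E_def)
  have "\<exists>\<sigma> \<tau>. 0 < \<sigma> \<and> \<sigma> < \<tau> \<and> \<tau> < 1 \<and> w + \<sigma> *\<^sub>R n i \<in> frontier K \<and> w + \<tau> *\<^sub>R n i \<in> interior K \<and>
      (\<forall>r<\<sigma>. w + r *\<^sub>R n i \<notin> K)" if i: "i \<in> Basis" for i
  proof -
    have "n i \<noteq> 0" by (rule vertex_frame_nonzero[OF n i])
    then have meet: "closed_segment w (w + n i) \<inter> interior K \<noteq> {}"
      using edges[of w "w + n i"] E[OF i] by (simp add: E_def)
    have "w + n i extreme_point_of R"
      using extreme_point_of_segment_face(2) E[OF i] unfolding E_def by blast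
    \<comment> \<open>In either case the far end is not interior, so the edge enters the interior
      strictly between its ends.\<close>
    then have "w + n i \<in> frontier K \<or> w + n i \<notin> K" using label by metis
    then have "w + n i \<notin> interior K" using interior_subset by (auto simp: frontier_def)
    then show ?thesis
      using segment_enters_body[OF cK \<open>w \<notin> K\<close> _ meet] by metis
  qed
  then obtain \<sigma> \<tau> where \<sigma>: "\<And>i. i \<in> Basis \<Longrightarrow> 0 < \<sigma> i \<and> \<sigma> i < \<tau> i \<and> \<tau> i < 1 \<and>
      w + \<sigma> i *\<^sub>R n i \<in> frontier K \<and> w + \<tau> i *\<^sub>R n i \<in> interior K \<and> (\<forall>r<\<sigma> i. w + r *\<^sub>R n i \<notin> K)"
    by metis
  define e where "e i = w + \<sigma> i *\<^sub>R n i" for i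
  \<comment> \<open>The argument names the vertex of the truncated \<open>Q\<close> that the new
    vertex on \<open>E i\<close> will realise. It depends only on \<open>f\<close>, so it is known
    before the position of the cut is chosen.\<close>
  define keep where "keep i \<longleftrightarrow> Q.cut_face (f (E i), True) \<in> S" for i
  \<comment> \<open>A new vertex that is to be cut off later retreats from its entry point towards
    \<open>w\<close>, to parameter \<open>(1 - t) * \<sigma> i\<close>, and so leaves
    \<open>K\<close>.\<close>
  define m where "m i = (if keep i then 0 else - (\<sigma> i *\<^sub>R n i))" for i
  have "closed_segment (e i) (e j) \<inter> interior K \<noteq> {}" if ij: "i \<in> Basis" "j \<in> Basis" "i \<noteq> j" for i j
  proof (rule segment_meets_interior[OF K])
    show "e i \<in> frontier K" "e j \<in> frontier K" using \<sigma> ij by (auto simp: e_def)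
    show "e i \<noteq> e j"
      using frame_directions_independent[OF n ij, of "\<sigma> i" "\<sigma> j"] \<sigma>[OF ij(1)] by (auto simp: e_def)
  qed
  then obtain t where t: "0 < t" "t < 1"
    and push: "\<And>i j. \<lbrakk>i \<in> Basis; j \<in> Basis; i \<noteq> j\<rbrakk> \<Longrightarrow>
      closed_segment (e i + t *\<^sub>R m i) (e j + t *\<^sub>R m j) \<inter> interior K \<noteq> {}"
    using perturbed_segments_meet_open[OF finite_Basis open_interior, of e K m] by metis
  define \<rho> where "\<rho> i = (if keep i then \<sigma> i else (1 - t) * \<sigma> i)" for i
  have \<rho>: "0 < \<rho> i" "\<rho> i \<le> \<sigma> i" "\<not> keep i \<Longrightarrow> \<rho> i < \<sigma> i" if "i \<in> Basis" for i
    using \<sigma>[OF that] t by (auto simp: \<rho>_def)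
  have "0 < \<rho> i \<and> \<rho> i < 1" if "i \<in> Basis" for i
    using \<rho>(1,2)[OF that] \<sigma>[OF that] by linarith
  then obtain a' b' where cut: "framed_cut R w a' b' n"
    and y: "\<And>i. i \<in> Basis \<Longrightarrow> framed_cut.y w a' b' n i = w + \<rho> i *\<^sub>R n i"
    using exists_framed_cut[OF polyR w(1) n, of \<rho>] by metis
  interpret R: framed_cut R w a' b' n by fact
  have y_push: "R.y i = e i + t *\<^sub>R m i" if "i \<in> Basis" for i
    unfolding y[OF that] by (simp add: e_def m_def \<rho>_def algebra_simps)
  obtain g where g: "face_iso g R.truncation Q.truncation"
    and g_cut: "\<And>F c. (F, c) \<in> R.cut_index \<Longrightarrow> g (R.cut_face (F, c)) = Q.cut_face (f F, c)"
    using face_iso_truncation[OF R.vertex_cut_axioms Q iso w(2)] by metis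
  have "if g {x} \<in> S then x \<in> frontier K else x \<notin> K" if x: "x extreme_point_of R.truncation" for x
  proof (cases rule: R.extreme_point_of_truncation_cases[OF x])
    case 1
    have xR: "{x} face_of R" using 1(1) face_of_singleton by blast
    have fx: "f {x} face_of Q" by (rule face_iso_face[OF iso xR])
    have "v \<notin> f {x}"
    proof
      assume "v \<in> f {x}"
      then have "f {w} \<subseteq> f {x}" by (simp add: w(2))
      then have "{w} \<subseteq> {x}"
        using face_iso_subset[OF iso _ xR, of "{w}"] w(1) face_of_singleton by blast
      then show False using 1(2) by simp
    qed
    then have "f {x} \<subseteq> {z. a \<bullet> z \<le> b}" using Q.face_below[OF fx] by (auto intro: less_imp_le)
    then have "Q.cut_face (f {x}, False) = f {x}" by (auto simp: Q.cut_face_def)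
    moreover have "({x}, False) \<in> R.cut_index" using xR 1(2) by (simp add: R.cut_index_def)
    moreover have "R.cut_face ({x}, False) = {x}" using 1(3) by (auto simp: R.cut_face_def)
    ultimately have "g {x} = f {x}" using g_cut[of "{x}" False] by simp
    moreover have "f {x} \<noteq> {v}" using \<open>v \<notin> f {x}\<close> by auto
    ultimately show ?thesis using label[OF 1(1)] by simp
  next
    case (2 i)
    have "g {x} = Q.cut_face (f (E i), True)"
      using g_cut[OF R.cut_edge(1)[OF 2(1)], of True] R.cut_edge(2)[OF 2(1)] 2(2) by (simp add: E_def)
    then have "g {x} \<in> S \<longleftrightarrow> keep i" by (simp add: keep_def)
    moreover have "x \<in> frontier K" if "keep i"
      using \<sigma>[OF 2(1)] y[OF 2(1)] 2(2) that by (simp add: \<rho>_def)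
    moreover have "x \<notin> K" if "\<not> keep i"
      using \<sigma>[OF 2(1)] \<rho>(3)[OF 2(1) that] y[OF 2(1)] 2(2) by simp
    ultimately show ?thesis by simp
  qed
  moreover have "closed_segment x x' \<inter> interior K \<noteq> {}"
    if x: "x \<noteq> x'" "closed_segment x x' face_of R.truncation" for x x'
  proof (cases rule: R.edge_of_truncation_cases[OF x])
    case 1
    then show ?thesis using edges x(1) by blast
  next
    case (2 i)
    \<comment> \<open>The interior point at \<open>\<tau> i\<close> lies beyond the cut, hence on
      the part of the edge that remains.\<close>
    have "\<rho> i \<le> \<tau> i" "\<rho> i \<le> 1" "\<tau> i \<le> 1" using \<sigma>[OF 2(1)] \<rho>(2)[OF 2(1)] by auto
    then have "w + \<tau> i *\<^sub>R n i \<in> closed_segment (w + \<rho> i *\<^sub>R n i) (w + 1 *\<^sub>R n i)"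
      by (subst closed_segment_ray) auto
    then have "w + \<tau> i *\<^sub>R n i \<in> closed_segment x x'"
      unfolding 2(2) y[OF 2(1)] by (simp add: closed_segment_commute)
    then show ?thesis using \<sigma>[OF 2(1)] by blast
  next
    case (3 i j)
    then show ?thesis using push[of i j] x(1) y_push by auto
  qed
  ultimately have "partially_inscribed K S R.truncation g Q.truncation"
    unfolding partially_inscribed_def using g R.simple_truncation[OF simple] by blast
  then show ?thesis unfolding Q.truncation_def by blast
qed

section \<open>The initial simplex and the induction\<close>

lemma sum_Basis_nonzero: "(\<Sum>(Basis :: 'a::euclidean_space set)) \<noteq> 0"
proof
  obtain i :: 'a where i: "i \<in> Basis" using nonempty_Basis by blast
  assume "(\<Sum>(Basis :: 'a set)) = 0"
  then show False using inner_sum_Basis[OF i] by simp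
qed

text \<open>On rays from an interior point \<open>p\<close> whose directions are the basis vectors
  and minus their sum, points at any positive distances are affinely independent. Each vertex can
  thus be placed freely on its ray: at the frontier or slightly beyond.\<close>

lemma partially_inscribed_simplex:
  fixes K :: "'a::euclidean_space set" and Q :: "'b::euclidean_space set"
  assumes K: "smooth_strictly_convex_body K" and Q: "int DIM('a) simplex Q"
  shows "\<exists>R f. partially_inscribed K S R f Q"
proof -
  have cK: "compact K" "convex K" "interior K \<noteq> {}"
    using K by (auto simp: smooth_strictly_convex_body_def convex_body_def)
  obtain A where A: "\<not> affine_dependent A" "int (card A) = int DIM('a) + 1" "Q = convex hull A"
    using Q by (auto simp: simplex_def)
  obtain p where p: "p \<in> interior K" using cK(3) by blast
  \<comment> \<open>The index 0 is reserved for the extra direction, minus the sum of the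
    basis.\<close>
  define J where "J = insert (0::'a) Basis"
  define dir where "dir j = (if j = 0 then - \<Sum>Basis else j)" for j :: 'a
  have J: "finite J" "card J = DIM('a) + 1" by (simp_all add: J_def)
  have dir: "dir j \<noteq> 0" if "j \<in> J" for j
    using that sum_Basis_nonzero by (auto simp: dir_def J_def)
  have indep: "\<forall>j\<in>J. \<mu> j = 0"
    if r: "\<And>j. j \<in> J \<Longrightarrow> r j > 0" and \<mu>: "(\<Sum>j\<in>J. \<mu> j) = 0" "(\<Sum>j\<in>J. \<mu> j *\<^sub>R (p + r j *\<^sub>R dir j)) = 0"
    for r \<mu> :: "'a \<Rightarrow> real"
  proof -
    have "(\<Sum>j\<in>J. \<mu> j *\<^sub>R (p + r j *\<^sub>R dir j)) = (\<Sum>j\<in>J. \<mu> j) *\<^sub>R p + (\<Sum>j\<in>J. (\<mu> j * r j) *\<^sub>R dir j)"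
      by (simp add: scaleR_add_right sum.distrib scaleR_sum_left)
    then have "(\<Sum>j\<in>J. (\<mu> j * r j) *\<^sub>R dir j) = 0" using \<mu> by simp
    moreover have "(\<Sum>j\<in>J. (\<mu> j * r j) *\<^sub>R dir j)
        = (\<mu> 0 * r 0) *\<^sub>R (- \<Sum>Basis) + (\<Sum>j\<in>Basis. (\<mu> j * r j) *\<^sub>R j)"
    proof -
      have "(\<Sum>j\<in>Basis. (\<mu> j * r j) *\<^sub>R dir j) = (\<Sum>j\<in>Basis. (\<mu> j * r j) *\<^sub>R j)"
        by (rule sum.cong) (auto simp: dir_def)
      then show ?thesis unfolding J_def by (subst sum.insert) (simp_all add: dir_def)
    qed
    ultimately have zero: "(\<mu> 0 * r 0) *\<^sub>R (- \<Sum>Basis) + (\<Sum>j\<in>Basis. (\<mu> j * r j) *\<^sub>R j) = 0"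
      by simp
    have eq: "\<mu> i * r i = \<mu> 0 * r 0" if i: "i \<in> Basis" for i
    proof -
      have "((\<mu> 0 * r 0) *\<^sub>R (- \<Sum>Basis) + (\<Sum>j\<in>Basis. (\<mu> j * r j) *\<^sub>R j)) \<bullet> i = 0"
        using zero by simp
      then show ?thesis using i by (simp add: inner_diff_left inner_sum_left_Basis inner_sum_Basis)
    qed
    have r0: "r 0 > 0" and ri: "\<And>i. i \<in> Basis \<Longrightarrow> r i > 0" using r by (auto simp: J_def)
    \<comment> \<open>All products \<open>\<mu> j * r j\<close> agree, so the coefficients share one
      sign; as they sum to zero, they vanish.\<close>
    have mi: "\<mu> i = \<mu> 0 * (r 0 / r i)" if "i \<in> Basis" for i
      using eq[OF that] ri[OF that] by (simp add: field_simps)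
    have "(\<Sum>j\<in>J. \<mu> j) = \<mu> 0 + (\<Sum>i\<in>Basis. \<mu> i)" unfolding J_def by (subst sum.insert) simp_all
    also have "(\<Sum>i\<in>Basis. \<mu> i) = (\<Sum>i\<in>Basis. \<mu> 0 * (r 0 / r i))" by (rule sum.cong) (simp_all only: mi)
    also have "\<mu> 0 + \<dots> = \<mu> 0 * (1 + (\<Sum>i\<in>Basis. r 0 / r i))"
      by (simp only: distrib_left sum_distrib_left mult_1_right)
    finally have "\<mu> 0 * (1 + (\<Sum>i\<in>Basis. r 0 / r i)) = 0" using \<mu>(1) by simp
    moreover have "(\<Sum>i\<in>Basis. r 0 / r i) \<ge> 0" using r0 ri by (intro sum_nonneg) (simp add: less_imp_le)
    ultimately have "\<mu> 0 = 0" by auto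
    then show ?thesis using mi by (simp add: J_def)
  qed
  have "\<exists>r>0. p + r *\<^sub>R dir j \<in> frontier K" if "j \<in> J" for j
    using ray_to_frontier[OF compact_imp_bounded[OF cK(1)] p dir[OF that]] by metis
  then obtain r0 where r0: "\<And>j. j \<in> J \<Longrightarrow> r0 j > 0 \<and> p + r0 j *\<^sub>R dir j \<in> frontier K" by metis
  have "card J = card A" using J(2) A(2) by simp
  then obtain h where h: "bij_betw h J A"
    using finite_same_card_bij[OF J(1) aff_independent_finite[OF A(1)]] by blast
  define e where "e j = p + r0 j *\<^sub>R dir j" for j
  define m where "m j = (if {h j} \<in> S then 0 else dir j)" for j
  have inj_e: "inj_on e J"
    by (rule affine_independent_family(1)[OF J(1)]) (use indep[of r0] r0 in \<open>simp add: e_def\<close>)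
  have "closed_segment (e i) (e j) \<inter> interior K \<noteq> {}" if ij: "i \<in> J" "j \<in> J" "i \<noteq> j" for i j
  proof (rule segment_meets_interior[OF K])
    show "e i \<in> frontier K" "e j \<in> frontier K" using r0 ij by (auto simp: e_def)
    show "e i \<noteq> e j" using inj_e ij by (auto dest: inj_onD)
  qed
  then obtain t where t: "0 < t" "t < 1"
    and push: "\<And>i j. \<lbrakk>i \<in> J; j \<in> J; i \<noteq> j\<rbrakk> \<Longrightarrow>
      closed_segment (e i + t *\<^sub>R m i) (e j + t *\<^sub>R m j) \<inter> interior K \<noteq> {}"
    using perturbed_segments_meet_open[OF J(1) open_interior, of e K m] by metis
  define r where "r j = (if {h j} \<in> S then r0 j else r0 j + t)" for j
  define u where "u j = p + r j *\<^sub>R dir j" for j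
  have u_push: "u j = e j + t *\<^sub>R m j" for j by (simp add: u_def e_def m_def r_def algebra_simps)
  have r_pos: "r j > 0" if "j \<in> J" for j using r0[OF that] t by (simp add: r_def)
  have inj_u: "inj_on u J" and U: "\<not> affine_dependent (u ` J)"
    by (rule affine_independent_family[OF J(1)]; use indep[of r] r_pos in \<open>simp add: u_def\<close>)+
  define U' where "U' = u ` J"
  define k where "k = h \<circ> inv_into J u"
  have k: "bij_betw k U' A"
    unfolding k_def U'_def using inj_u h by (intro bij_betw_trans[OF bij_betw_inv_into]) (auto simp: bij_betw_def)
  define f where "f F = convex hull (k ` (F \<inter> U'))" for F
  have fu: "f {u j} = {h j}" if "j \<in> J" for j
    using that inv_into_f_f[OF inj_u that] by (simp add: f_def U'_def k_def)
  have "partially_inscribed K S (convex hull U') f Q"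
    unfolding partially_inscribed_def
  proof (intro conjI allI impI)
    have "card U' = DIM('a) + 1" using card_image[OF inj_u] J(2) by (simp add: U'_def)
    then show "simple_polytope (convex hull U')" using simple_simplex U by (simp add: U'_def)
    show "face_iso f (convex hull U') Q"
      unfolding A(3) f_def using face_iso_simplex[OF _ A(1) k] U by (simp add: U'_def)
  next
    fix x assume "x extreme_point_of convex hull U'"
    then have "x \<in> U'" by (rule extreme_point_of_convex_hull)
    then obtain j where j: "j \<in> J" "x = u j" by (auto simp: U'_def)
    have fx: "f {x} = {h j}" using fu[OF j(1)] j(2) by simp
    show "if f {x} \<in> S then x \<in> frontier K else x \<notin> K"
    proof (cases "{h j} \<in> S")
      case True
      then have "x \<in> frontier K" using j r0[OF j(1)] by (simp add: u_def r_def)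
      then show ?thesis using True fx by simp
    next
      case False
      have "u j \<notin> K" unfolding u_def
        by (rule outside_beyond_frontier[OF cK(2) p, of "r0 j"]) (use r0[OF j(1)] t False in \<open>simp_all add: r_def\<close>)
      then show ?thesis using False j(2) fx by simp
    qed
  next
    fix x x' assume x: "x \<noteq> x'" "closed_segment x x' face_of convex hull U'"
    have "x \<in> U'" "x' \<in> U'"
      using extreme_point_of_segment_face[OF x(2)] extreme_point_of_convex_hull by blast+
    then obtain i j where "i \<in> J" "x = u i" "j \<in> J" "x' = u j" by (auto simp: U'_def)
    then show "closed_segment x x' \<inter> interior K \<noteq> {}"
      using push[of i j] x(1) u_push by auto
  qed
  then show ?thesis by blast
qed

lemma polytope_iterated_vertex_truncation:
  assumes "iterated_vertex_truncation d Q" shows "polytope Q"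
  using assms
proof induction
  case (simplex P)
  then show ?case by (rule simplex_imp_polytope)
next
  case (truncate P v a b)
  then show ?case by (intro polytope_Int_polyhedron polyhedron_halfspace_le)
qed

text \<open>\<open>S\<close> is generalised because the induction hypothesis is applied to
  \<open>S - {{v}}\<close>.\<close>

lemma partially_inscribed_iterated_vertex_truncation:
  fixes K :: "'a::euclidean_space set" and Q :: "'b::euclidean_space set"
  assumes K: "smooth_strictly_convex_body K" and Q: "iterated_vertex_truncation DIM('a) Q"
  shows "\<exists>R f. partially_inscribed K S R f Q"
  using Q
proof (induction arbitrary: S)
  case (simplex P)
  then show ?case by (rule partially_inscribed_simplex[OF K])
next
  case (truncate P v a b)
  have "vertex_cut P v a b"
    using truncate polytope_iterated_vertex_truncation by unfold_locales auto
  then show ?case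
    using partially_inscribed_truncation[OF K] truncate.IH[of "S - {{v}}"] by blast
qed

theorem proposition5p4:
  fixes P :: "'b::euclidean_space set" and K :: "'a::euclidean_space set"
  assumes "truncated_polytope DIM('a) P"
    and "smooth_strictly_convex_body K"
  shows "\<exists>Q::'a set. polytope Q \<and> combinatorially_equivalent P Q \<and>
           (\<forall>v. v extreme_point_of Q \<longrightarrow> v \<in> frontier K)"
proof -
  obtain T :: "'b set" where T: "iterated_vertex_truncation DIM('a) T" "combinatorially_equivalent P T"
    using assms(1) by (auto simp: truncated_polytope_def)
  \<comment> \<open>With every label present, no vertex is left waiting outside
    \<open>K\<close>.\<close>
  obtain R f where R: "partially_inscribed K UNIV R f T"
    using partially_inscribed_iterated_vertex_truncation[OF assms(2) T(1)] by blast
  then have "polytope R" "\<forall>v. v extreme_point_of R \<longrightarrow> v \<in> frontier K" "face_iso f R T"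
    by (simp_all add: partially_inscribed_def simple_polytope_def)
  moreover from \<open>face_iso f R T\<close> have "combinatorially_equivalent P R"
    using T(2) combinatorially_equivalent_sym combinatorially_equivalent_trans
      combinatorially_equivalent_iff_face_iso by blast
  ultimately show ?thesis by blast
qed

end
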